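(* Let $I$ be a nonempty set and $S$ a semigroup. Let $E$ be a real, strictly convex, reflexive, smooth Banach space, and for each $i\in I$ let $C_i$ be a nonempty compact convex subset of $E$. Equip the product space $E^{I}$ (all functions $I\to E$) with the product topology generated by the norm topology on each factor $E$. For each $i\in I$ let $\mathcal{S}_i=\{T_{s,i}:s\in S\}$ be a representation of $S$ as nonexpansive mappings from $C_i$ into itself with $\mathrm{Fix}(\mathcal{S}_i)\neq\emptyset$. Let $X$ be a left invariant subspace of $B(S)$ with $1\in X$ such that for every $i\in I$, $x\in C_i$ and $x^*\in E^*$ the function $t\mapsto\langle T_{t,i}x,x^*\rangle$ belongs to $X$. Let $\{\mu_n\}$ be a left regular sequence of means on $X$. For each $i\in I$ let $f_i:C_i\to C_i$ be an $\alpha_i$-contraction, i.e. $\|f_i(x)-f_i(y)\|\le\alpha_i\|x-y\|$ for all $x,y\in C_i$, where $0\le\alpha_i<1$. Let $\{\epsilon_n\}$ be a sequence in $(0,1)$ with $\lim_n\epsilon_n=0$. Then for each $i\in I$ there exist a unique sunny nonexpansive retraction $P_i$ of $C_i$ onto $\mathrm{Fix}(\mathcal{S}_i)$ and a point $x_i\in C_i$ such that the sequence $\{g_n\}$ in $E^I$ defined by $g_n(i)=z_{n,i}$ $(i\in I)$, where for each $n$ and $i$ the point $z_{n,i}\in C_i$ satisfies $$z_{n,i}=\epsilon_n f_i(z_{n,i})+(1-\epsilon_n)T_{\mu_{n},i}\,z_{n,i},$$ converges in the product topology of $E^I$ to the function $g:I\to E$ defined by $g(i)=P_ix_i$.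
   Context: $B(S)$ is the Banach space of bounded real-valued functions on $S$ with the sup norm; for $s\in S$ and $h\in B(S)$, $(l_sh)(t)=h(st)$. A subspace $X\subseteq B(S)$ is left invariant if $l_s(X)\subseteq X$ for all $s\in S$. A mean on $X$ is $\mu\in X^*$ with $\|\mu\|=\mu(1)=1$. A sequence $\{\mu_n\}$ of means on $X$ is left regular if $\lim_n\|l_s^*\mu_n-\mu_n\|=0$ for each $s\in S$, where $l_s^*$ is the adjoint of $l_s$. A family $\{T_s:s\in S\}$ of self-maps of $C$ is a representation of $S$ as nonexpansive mappings if $T_{st}x=T_sT_tx$ for all $s,t\in S$, $x\in C$, and each $T_s$ is nonexpansive; $\mathrm{Fix}(\mathcal{S})=\bigcap_{s\in S}\{x\in C:T_sx=x\}$. For a mean $\mu$ on $X$ and $x\in C_i$, $T_{\mu,i}x$ denotes the unique element $y\in E$ with $\langle y,x^*\rangle=\mu_t\langle T_{t,i}x,x^*\rangle$ for all $x^*\in E^*$ (written $\int T_{t,i}x\,d\mu(t)$). A retraction $P$ of $C$ onto $D\subseteq C$ (i.e. $Px=x$ for $x\in D$) is sunny if $P(Px+t(x-Px))=Px$ whenever $x\in C$, $t\ge 0$ and $Px+t(x-Px)\in C$. *)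

theory Defs
  imports "HOL-Analysis.Analysis"
begin

definition reflexive_space :: "'e::real_normed_vector itself \<Rightarrow> bool" where
  "reflexive_space _ \<longleftrightarrow>
     (\<forall>\<phi> :: ('e \<Rightarrow>\<^sub>L real) \<Rightarrow>\<^sub>L real. \<exists>x::'e. \<forall>f. blinfun_apply \<phi> f = blinfun_apply f x)"

definition strictly_convex_space :: "'e::real_normed_vector itself \<Rightarrow> bool" where
  "strictly_convex_space _ \<longleftrightarrow>
     (\<forall>x y::'e. norm x = 1 \<and> norm y = 1 \<and> x \<noteq> y \<longrightarrow> norm ((1/2) *\<^sub>R (x + y)) < 1)"

definition smooth_space :: "'e::real_normed_vector itself \<Rightarrow> bool" where
  "smooth_space _ \<longleftrightarrow>
     (\<forall>x y::'e. norm x = 1 \<and> norm y = 1 \<longrightarrow>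
        (\<exists>l. ((\<lambda>t::real. (norm (x + t *\<^sub>R y) - norm x) / t) \<longlongrightarrow> l) (at 0)))"

definition nonexpansive_on :: "'e::real_normed_vector set \<Rightarrow> ('e \<Rightarrow> 'e) \<Rightarrow> bool" where
  "nonexpansive_on C T \<longleftrightarrow> (\<forall>x\<in>C. \<forall>y\<in>C. norm (T x - T y) \<le> norm (x - y))"

definition retraction_onto :: "'e set \<Rightarrow> 'e set \<Rightarrow> ('e \<Rightarrow> 'e) \<Rightarrow> bool" where
  "retraction_onto C D P \<longleftrightarrow> D \<subseteq> C \<and> P ` C = D \<and> (\<forall>x\<in>D. P x = x)"

definition sunny_on :: "'e::real_vector set \<Rightarrow> ('e \<Rightarrow> 'e) \<Rightarrow> bool" where
  "sunny_on C P \<longleftrightarrow>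
     (\<forall>x\<in>C. \<forall>t::real. t \<ge> 0 \<and> P x + t *\<^sub>R (x - P x) \<in> C \<longrightarrow>
        P (P x + t *\<^sub>R (x - P x)) = P x)"

definition sunny_nonexpansive_retraction :: "'e::real_normed_vector set \<Rightarrow> 'e set \<Rightarrow> ('e \<Rightarrow> 'e) \<Rightarrow> bool" where
  "sunny_nonexpansive_retraction C D P \<longleftrightarrow>
     retraction_onto C D P \<and> sunny_on C P \<and> nonexpansive_on C P"

definition supnorm :: "('s \<Rightarrow> real) \<Rightarrow> real" where
  "supnorm h = (SUP t. \<bar>h t\<bar>)"

definition bounded_fun :: "('s \<Rightarrow> real) \<Rightarrow> bool" where
  "bounded_fun h \<longleftrightarrow> (\<exists>M. \<forall>t. \<bar>h t\<bar> \<le> M)"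

definition left_translate :: "'s::semigroup_mult \<Rightarrow> ('s \<Rightarrow> real) \<Rightarrow> ('s \<Rightarrow> real)" where
  "left_translate s h = (\<lambda>t. h (s * t))"

definition subspace_B :: "('s \<Rightarrow> real) set \<Rightarrow> bool" where
  "subspace_B X \<longleftrightarrow> (\<forall>h\<in>X. bounded_fun h) \<and> (\<lambda>_. 0) \<in> X \<and>
     (\<forall>h\<in>X. \<forall>k\<in>X. (\<lambda>t. h t + k t) \<in> X) \<and> (\<forall>h\<in>X. \<forall>c::real. (\<lambda>t. c * h t) \<in> X)"

definition left_invariant :: "('s::semigroup_mult \<Rightarrow> real) set \<Rightarrow> bool" where
  "left_invariant X \<longleftrightarrow> (\<forall>s. \<forall>h\<in>X. left_translate s h \<in> X)"

definition linear_on_X :: "('s \<Rightarrow> real) set \<Rightarrow> (('s \<Rightarrow> real) \<Rightarrow> real) \<Rightarrow> bool" where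
  "linear_on_X X \<mu> \<longleftrightarrow> (\<forall>h\<in>X. \<forall>k\<in>X. \<mu> (\<lambda>t. h t + k t) = \<mu> h + \<mu> k) \<and>
     (\<forall>h\<in>X. \<forall>c. \<mu> (\<lambda>t. c * h t) = c * \<mu> h)"

definition bounded_functional :: "('s \<Rightarrow> real) set \<Rightarrow> (('s \<Rightarrow> real) \<Rightarrow> real) \<Rightarrow> bool" where
  "bounded_functional X \<phi> \<longleftrightarrow> linear_on_X X \<phi> \<and> (\<exists>M. \<forall>h\<in>X. \<bar>\<phi> h\<bar> \<le> M * supnorm h)"

definition fnorm :: "('s \<Rightarrow> real) set \<Rightarrow> (('s \<Rightarrow> real) \<Rightarrow> real) \<Rightarrow> real" where
  "fnorm X \<phi> = Sup {\<bar>\<phi> h\<bar> | h. h \<in> X \<and> supnorm h \<le> 1}"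

definition mean_on :: "('s \<Rightarrow> real) set \<Rightarrow> (('s \<Rightarrow> real) \<Rightarrow> real) \<Rightarrow> bool" where
  "mean_on X \<mu> \<longleftrightarrow> bounded_functional X \<mu> \<and> fnorm X \<mu> = 1 \<and> \<mu> (\<lambda>_. 1) = 1"

definition left_regular :: "('s::semigroup_mult \<Rightarrow> real) set \<Rightarrow> (nat \<Rightarrow> ('s \<Rightarrow> real) \<Rightarrow> real) \<Rightarrow> bool" where
  "left_regular X \<mu> \<longleftrightarrow> (\<forall>n. mean_on X (\<mu> n)) \<and>
     (\<forall>s. (\<lambda>n. fnorm X (\<lambda>h. \<mu> n (left_translate s h) - \<mu> n h)) \<longlonglongrightarrow> 0)"

definition nonexpansive_representation ::
  "'e::real_normed_vector set \<Rightarrow> ('s::semigroup_mult \<Rightarrow> 'e \<Rightarrow> 'e) \<Rightarrow> bool" where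
  "nonexpansive_representation C T \<longleftrightarrow>
     (\<forall>s. T s ` C \<subseteq> C) \<and> (\<forall>s t. \<forall>x\<in>C. T (s * t) x = T s (T t x)) \<and>
     (\<forall>s. nonexpansive_on C (T s))"

definition Fix_rep :: "'e set \<Rightarrow> ('s \<Rightarrow> 'e \<Rightarrow> 'e) \<Rightarrow> 'e set" where
  "Fix_rep C T = {x \<in> C. \<forall>s. T s x = x}"

definition T_mean :: "(('s \<Rightarrow> real) \<Rightarrow> real) \<Rightarrow> ('s \<Rightarrow> 'e::real_normed_vector \<Rightarrow> 'e) \<Rightarrow> 'e \<Rightarrow> 'e" where
  "T_mean \<mu> T x = (THE y. \<forall>f :: 'e \<Rightarrow>\<^sub>L real. blinfun_apply f y = \<mu> (\<lambda>t. blinfun_apply f (T t x)))"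

end

theory Submission
  imports Defs "HOL-Library.Function_Algebras"
begin

text \<open>
  Fix an index and put \<open>D = Fix(S)\<close>.  Along any convergent subsequence of the implicit iterates,
  with limit \<open>q\<close>, the point \<open>q\<close> is approximately fixed by the mean operators.  By left
  regularity and Hahn-Banach separation there is, for each \<open>\<delta> > 0\<close>, one finite convex combination
  \<open>\<lambda>\<close> on the orbit of \<open>q\<close> with \<open>\<parallel>\<Sum>t. \<lambda> t T s (T t q) - q\<parallel> \<le> \<delta>\<close> for all \<open>s\<close> simultaneously.
  Translating the finitely many orbit points so that the sum of their mutual distances becomes
  minimal in the limit, one gets a configuration on which every \<open>T u\<close> is isometric; by strict
  convexity \<open>T u\<close> is then affine on its convex hull, so it moves \<open>q\<close> by at most \<open>2 \<delta>\<close>.  Hence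
  \<open>q \<in> D\<close>.

  Since the mean operators are nonexpansive and fix \<open>D\<close>, convexity of the norm gives
  \<open>\<parallel>q - p\<parallel> \<le> \<parallel>q - p + t (f q - q)\<parallel>\<close> for \<open>p \<in> D\<close>, \<open>t \<ge> 0\<close>.  Smoothness makes such a \<open>q\<close> unique,
  so the whole sequence converges.  For constant \<open>f = u\<close> the limit is the value at \<open>u\<close> of the
  sunny nonexpansive retraction, and for general \<open>f\<close> the limit is itself a point of \<open>D\<close>, so it
  can serve as the point \<open>x\<close> of the theorem.
\<close>

section \<open>The Hahn-Banach theorem via minimal sublinear functionals\<close>

text \<open>Homogeneity is asked only as an inequality for positive factors; using it once more with
  \<open>inverse t\<close> turns it into an equality.\<close>

definition sublinear :: "(real \<Rightarrow> 'b::ab_group_add \<Rightarrow> 'b) \<Rightarrow> ('b \<Rightarrow> real) \<Rightarrow> bool" where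
  "sublinear sc p \<longleftrightarrow>
     (\<forall>x y. p (x + y) \<le> p x + p y) \<and> (\<forall>t>0. \<forall>x. p (sc t x) \<le> t * p x)"

text \<open>A set of lower bounds \<open>r\<close> on the values at \<open>g\<close> that a linear functional below \<open>p\<close>
  is to satisfy.\<close>

definition dominated_cone ::
  "(real \<Rightarrow> 'b::ab_group_add \<Rightarrow> 'b) \<Rightarrow> ('b \<Rightarrow> real) \<Rightarrow> ('b \<times> real) set \<Rightarrow> bool" where
  "dominated_cone sc p G \<longleftrightarrow> (0, 0) \<in> G \<and>
     (\<forall>g r h s. (g, r) \<in> G \<longrightarrow> (h, s) \<in> G \<longrightarrow> (g + h, r + s) \<in> G) \<and>
     (\<forall>g r. \<forall>t>0. (g, r) \<in> G \<longrightarrow> (sc t g, t * r) \<in> G) \<and>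
     (\<forall>g r. (g, r) \<in> G \<longrightarrow> r \<le> p g)"

text \<open>A linear \<open>f\<close> lies below \<open>cone_shift p G\<close> exactly when
  \<open>f \<le> p\<close> and \<open>r \<le> f g\<close> for all \<open>(g, r) \<in> G\<close>. The
  lower bounds are thus absorbed into a single sublinear majorant.\<close>

definition cone_shift :: "('b::ab_group_add \<Rightarrow> real) \<Rightarrow> ('b \<times> real) set \<Rightarrow> 'b \<Rightarrow> real" where
  "cone_shift p G x = (INF (g, r)\<in>G. p (x + g) - r)"

text \<open>Scaling is a parameter because the theorem is applied to two spaces: a normed space with
  \<open>scaleR\<close>, and the functions from \<open>'s\<close> to \<open>'e\<close> with
  pointwise scaling.\<close>

locale real_vector_space = vector_space sc
  for sc :: "real \<Rightarrow> 'b::ab_group_add \<Rightarrow> 'b" (infixr \<open>\<star>\<close> 75)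
begin

lemma sublinear_add: "sublinear (\<star>) p \<Longrightarrow> p (x + y) \<le> p x + p y"
  by (simp add: sublinear_def)

lemma sublinear_scale:
  assumes p: "sublinear (\<star>) p" and t: "t > 0"
  shows "p (t \<star> x) = t * p x"
proof (rule antisym)
  show "p (t \<star> x) \<le> t * p x" using assms by (simp add: sublinear_def)
  have "p x \<le> inverse t * p (t \<star> x)"
    using p[unfolded sublinear_def, THEN conjunct2, rule_format, of "inverse t" "t \<star> x"] t by simp
  then show "t * p x \<le> p (t \<star> x)" using t by (simp add: field_simps)
qed

lemma sublinear_zero: "sublinear (\<star>) p \<Longrightarrow> p 0 = 0"
  using sublinear_scale[of p 2 0] by simp

lemma sublinear_uminus_le: "sublinear (\<star>) p \<Longrightarrow> - p (- x) \<le> p x"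
  using sublinear_add[of p x "- x"] sublinear_zero[of p] by simp

lemma cone_shift_bdd_below:
  assumes p: "sublinear (\<star>) p" and G: "dominated_cone (\<star>) p G"
  shows "bdd_below ((\<lambda>(g, r). p (x + g) - r) ` G)"
proof (rule bdd_belowI)
  fix v assume "v \<in> (\<lambda>(g, r). p (x + g) - r) ` G"
  then obtain g r where gr: "(g, r) \<in> G" "v = p (x + g) - r" by auto
  have "p g \<le> p (x + g) + p (- x)"
    using sublinear_add[OF p, of "x + g" "- x"] by simp
  moreover have "r \<le> p g" using G gr by (auto simp: dominated_cone_def)
  ultimately show "- p (- x) \<le> v" using gr by simp
qed

lemma cone_shift_lower:
  assumes "sublinear (\<star>) p" "dominated_cone (\<star>) p G" "(g, r) \<in> G"
  shows "cone_shift p G x \<le> p (x + g) - r"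
  unfolding cone_shift_def
  using cINF_lower[OF cone_shift_bdd_below[OF assms(1,2)] assms(3)] by simp

lemma cone_shift_greatest:
  assumes "dominated_cone (\<star>) p G" "\<And>g r. (g, r) \<in> G \<Longrightarrow> m \<le> p (x + g) - r"
  shows "m \<le> cone_shift p G x"
  unfolding cone_shift_def using assms
  by (intro cINF_greatest) (auto simp: dominated_cone_def)

lemma cone_shift_le:
  assumes "sublinear (\<star>) p" "dominated_cone (\<star>) p G"
  shows "cone_shift p G x \<le> p x"
  using cone_shift_lower[OF assms, of 0 0 x] assms(2) by (simp add: dominated_cone_def)

lemma cone_shift_uminus:
  assumes "sublinear (\<star>) p" "dominated_cone (\<star>) p G" "(g, r) \<in> G"
  shows "cone_shift p G (- g) \<le> - r"
  using cone_shift_lower[OF assms, of "- g"] sublinear_zero[OF assms(1)] by simp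

text \<open>The sum of two members of \<open>G\<close> is again a member and so competes in the
  infimum at \<open>x + y\<close>; the two infima are then taken one after the other. Scaling works
  the same way, since \<open>G\<close> is a cone.\<close>

lemma sublinear_cone_shift:
  assumes p: "sublinear (\<star>) p" and G: "dominated_cone (\<star>) p G"
  shows "sublinear (\<star>) (cone_shift p G)"
  unfolding sublinear_def
proof (intro conjI allI impI)
  fix x y
  have *: "cone_shift p G (x + y) \<le> (p (x + g) - r) + (p (y + h) - s)"
    if gr: "(g, r) \<in> G" and hs: "(h, s) \<in> G" for g r h s
  proof -
    have "(g + h, r + s) \<in> G" using G gr hs by (auto simp: dominated_cone_def)
    then have "cone_shift p G (x + y) \<le> p ((x + y) + (g + h)) - (r + s)"
      by (rule cone_shift_lower[OF p G])
    also have "(x + y) + (g + h) = (x + g) + (y + h)" by simp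
    also have "p \<dots> \<le> p (x + g) + p (y + h)" by (rule sublinear_add[OF p])
    finally show ?thesis by simp
  qed
  have "cone_shift p G (x + y) - (p (x + g) - r) \<le> cone_shift p G y" if "(g, r) \<in> G" for g r
    by (rule cone_shift_greatest[OF G]) (use *[OF that] in force)
  then have "cone_shift p G (x + y) - cone_shift p G y \<le> cone_shift p G x"
    by (intro cone_shift_greatest[OF G]) force
  then show "cone_shift p G (x + y) \<le> cone_shift p G x + cone_shift p G y" by simp
next
  fix t :: real and x assume t: "t > 0"
  have "cone_shift p G (t \<star> x) / t \<le> cone_shift p G x"
  proof (rule cone_shift_greatest[OF G])
    fix g r assume "(g, r) \<in> G"
    then have "(t \<star> g, t * r) \<in> G" using G t by (auto simp: dominated_cone_def)
    then have "cone_shift p G (t \<star> x) \<le> p (t \<star> x + t \<star> g) - t * r"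
      by (rule cone_shift_lower[OF p G])
    also have "\<dots> = t * (p (x + g) - r)"
      using sublinear_scale[OF p t, of "x + g"] by (simp add: scale_right_distrib algebra_simps)
    finally show "cone_shift p G (t \<star> x) / t \<le> p (x + g) - r"
      using t by (simp add: field_simps)
  qed
  then show "cone_shift p G (t \<star> x) \<le> t * cone_shift p G x" using t by (simp add: field_simps)
qed

text \<open>Of two members of a chain the smaller one lies below both, and its own subadditivity
  bounds the infimum at \<open>x + y\<close>.\<close>

lemma sublinear_INF_chain:
  assumes ne: "Q \<noteq> {}" and sub: "\<And>q. q \<in> Q \<Longrightarrow> sublinear (\<star>) q"
    and chain: "\<And>q q'. q \<in> Q \<Longrightarrow> q' \<in> Q \<Longrightarrow> q \<le> q' \<or> q' \<le> q"
    and bdd: "\<And>x. bdd_below ((\<lambda>q. q x) ` Q)"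
  shows "sublinear (\<star>) (\<lambda>x. INF q\<in>Q. q x)"
  unfolding sublinear_def
proof (intro conjI allI impI)
  define u where "u = (\<lambda>x. INF q\<in>Q. q x)"
  have lower: "u x \<le> q x" if "q \<in> Q" for q x
    unfolding u_def by (rule cINF_lower[OF bdd that])
  fix x y
  have *: "u (x + y) \<le> q x + q' y" if q: "q \<in> Q" "q' \<in> Q" for q q'
  proof -
    obtain r where r: "r \<in> Q" "r \<le> q" "r \<le> q'" using chain[OF q] q by blast
    have "u (x + y) \<le> r (x + y)" by (rule lower[OF r(1)])
    also have "\<dots> \<le> r x + r y" by (rule sublinear_add[OF sub[OF r(1)]])
    also have "\<dots> \<le> q x + q' y" using r by (intro add_mono) (auto simp: le_fun_def)
    finally show ?thesis .
  qed
  have "u (x + y) - q x \<le> u y" if "q \<in> Q" for q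
    unfolding u_def[THEN fun_cong, of y]
    by (rule cINF_greatest[OF ne]) (use *[OF that] in force)
  then have "u (x + y) - u y \<le> u x"
    unfolding u_def[THEN fun_cong, of x]
    by (intro cINF_greatest[OF ne]) force
  then show "(INF q\<in>Q. q (x + y)) \<le> (INF q\<in>Q. q x) + (INF q\<in>Q. q y)" by (simp add: u_def)
next
  fix t :: real and x assume t: "t > 0"
  have "(INF q\<in>Q. q (t \<star> x)) / t \<le> (INF q\<in>Q. q x)"
  proof (rule cINF_greatest[OF ne])
    fix q assume q: "q \<in> Q"
    have "(INF q\<in>Q. q (t \<star> x)) \<le> q (t \<star> x)" by (rule cINF_lower[OF bdd q])
    then show "(INF q\<in>Q. q (t \<star> x)) / t \<le> q x"
      using sublinear_scale[OF sub[OF q] t, of x] t by (simp add: field_simps)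
  qed
  then show "(INF q\<in>Q. q (t \<star> x)) \<le> t * (INF q\<in>Q. q x)" using t by (simp add: field_simps)
qed

lemma minimal_sublinear_exists:
  assumes p: "sublinear (\<star>) p"
  obtains m where "sublinear (\<star>) m" "m \<le> p"
    "\<And>q. sublinear (\<star>) q \<Longrightarrow> q \<le> m \<Longrightarrow> q = m"
proof -
  define A where "A = {q. sublinear (\<star>) q \<and> q \<le> p}"
  have "\<exists>m\<in>A. \<forall>q\<in>A. q \<le> m \<longrightarrow> q = m"
  \<comment> \<open>Zorn's lemma yields maximal elements, so the order is reversed.\<close>
  proof (rule predicate_Zorn[where P = "\<lambda>q q'. q' \<le> q"])
    show "partial_order_on A (relation_of (\<lambda>q q'. q' \<le> q) A)"
      by (rule partial_order_on_relation_ofI) auto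
    fix Q assume Q: "Q \<in> Chains (relation_of (\<lambda>q q'. q' \<le> q) A)"
    then have QA: "Q \<subseteq> A" by (auto simp: Chains_def relation_of_def)
    have chain: "q \<le> q' \<or> q' \<le> q" if "q \<in> Q" "q' \<in> Q" for q q'
      using Q that by (auto simp: Chains_def relation_of_def)
    show "\<exists>u\<in>A. \<forall>a\<in>Q. u \<le> a"
    proof (cases "Q = {}")
      case True
      then show ?thesis using p by (auto simp: A_def)
    next
      case False
      have bdd: "bdd_below ((\<lambda>q. q x) ` Q)" for x
      \<comment> \<open>The bound \<open>- p (- x)\<close> does not depend on \<open>q\<close>,
        which keeps the pointwise infimum finite.\<close>
      proof (rule bdd_belowI2[where m = "- p (- x)"])
        fix q assume "q \<in> Q"
        then have "sublinear (\<star>) q" "q (- x) \<le> p (- x)" using QA by (auto simp: A_def le_fun_def)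
        then show "- p (- x) \<le> q x" using sublinear_uminus_le[of q x] by simp
      qed
      define u where "u = (\<lambda>x. INF q\<in>Q. q x)"
      have le: "u \<le> q" if "q \<in> Q" for q
        unfolding u_def le_fun_def using cINF_lower[OF bdd that] by simp
      have "sublinear (\<star>) u"
        unfolding u_def by (rule sublinear_INF_chain[OF False _ chain bdd]) (use QA A_def in auto)
      moreover obtain q where "q \<in> Q" using False by blast
      then have "u \<le> p" using le[of q] QA by (auto simp: A_def intro: order_trans)
      ultimately show ?thesis using le by (auto simp: A_def)
    qed
  qed
  then obtain m where m: "m \<in> A" "\<And>q. q \<in> A \<Longrightarrow> q \<le> m \<Longrightarrow> q = m" by blast
  show thesis
  proof (rule that)
    show "sublinear (\<star>) m" "m \<le> p" using m(1) by (auto simp: A_def)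
    show "q = m" if "sublinear (\<star>) q" "q \<le> m" for q
      using m that order_trans by (auto simp: A_def)
  qed
qed

text \<open>Shifting \<open>m\<close> along the ray through \<open>y\<close>, with the values of
  \<open>m\<close> itself as lower bounds, gives a sublinear functional below \<open>m\<close>. By
  minimality it equals \<open>m\<close>, and evaluating it with the generator
  \<open>(y, m y)\<close> is superadditivity.\<close>

lemma minimal_sublinear_add:
  assumes m: "sublinear (\<star>) m" and min: "\<And>q. sublinear (\<star>) q \<Longrightarrow> q \<le> m \<Longrightarrow> q = m"
  shows "m (x + y) = m x + m y"
proof (rule antisym)
  show "m (x + y) \<le> m x + m y" by (rule sublinear_add[OF m])
  define G where "G = {(t \<star> y, t * m y) | t. t \<ge> 0}"
  have G: "dominated_cone (\<star>) m G"
    unfolding dominated_cone_def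
  proof (intro conjI allI impI)
    show "(0, 0) \<in> G" unfolding G_def by (auto intro!: exI[of _ 0])
    show "(g + h, r + s) \<in> G" if "(g, r) \<in> G" "(h, s) \<in> G" for g r h s
    proof -
      from that(1) obtain t where t: "t \<ge> 0" "g = t \<star> y" "r = t * m y" by (auto simp: G_def)
      from that(2) obtain u where "u \<ge> 0" "h = u \<star> y" "s = u * m y" by (auto simp: G_def)
      with t show ?thesis unfolding G_def
        by (auto intro!: exI[of _ "t + u"] simp: scale_left_distrib algebra_simps)
    qed
    show "(t \<star> g, t * r) \<in> G" if "t > 0" "(g, r) \<in> G" for g r t
    proof -
      from that obtain u where "u \<ge> 0" "g = u \<star> y" "r = u * m y" by (auto simp: G_def)
      then show ?thesis unfolding G_def using that by (auto intro!: exI[of _ "t * u"])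
    qed
    show "r \<le> m g" if "(g, r) \<in> G" for g r
    proof -
      from that obtain t where t: "t \<ge> 0" "g = t \<star> y" "r = t * m y" by (auto simp: G_def)
      show ?thesis
        using t sublinear_zero[OF m] sublinear_scale[OF m, of t y] by (cases "t = 0") auto
    qed
  qed
  have "cone_shift m G = m"
    by (rule min[OF sublinear_cone_shift[OF m G]]) (simp add: le_fun_def cone_shift_le[OF m G])
  moreover have "(y, m y) \<in> G" unfolding G_def by (auto intro!: exI[of _ 1])
  ultimately show "m x + m y \<le> m (x + y)" using cone_shift_lower[OF m G, of y "m y" x] by simp
qed

text \<open>A minimal sublinear functional below \<open>cone_shift p G\<close> is additive, hence
  linear, and lying below the shift carries both required bounds.\<close>

lemma Hahn_Banach_cone:
  assumes p: "sublinear (\<star>) p" and G: "dominated_cone (\<star>) p G"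
  obtains f where "\<And>x y. f (x + y) = f x + f y" "\<And>t x. f (t \<star> x) = t * f x"
    "\<And>x. f x \<le> p x" "\<And>g r. (g, r) \<in> G \<Longrightarrow> r \<le> f g"
proof -
  obtain m where m: "sublinear (\<star>) m" "m \<le> cone_shift p G"
    and min: "\<And>q. sublinear (\<star>) q \<Longrightarrow> q \<le> m \<Longrightarrow> q = m"
    using minimal_sublinear_exists[OF sublinear_cone_shift[OF p G]] by blast
  have add: "m (x + y) = m x + m y" for x y by (rule minimal_sublinear_add[OF m(1) min])
  have minus: "m (- x) = - m x" for x using add[of x "- x"] sublinear_zero[OF m(1)] by simp
  show thesis
  proof (rule that[of m])
    show "m (x + y) = m x + m y" for x y by (rule add)
    show "m x \<le> p x" for x
      using m(2) cone_shift_le[OF p G, of x] by (auto simp: le_fun_def intro: order_trans)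
    show "m (t \<star> x) = t * m x" for t x
    proof (cases t "0 :: real" rule: linorder_cases)
      case less
      then show ?thesis using sublinear_scale[OF m(1), of "- t" x] minus[of "t \<star> x"] by simp
    next
      case equal
      then show ?thesis using sublinear_zero[OF m(1)] by simp
    next
      case greater
      then show ?thesis by (rule sublinear_scale[OF m(1)])
    qed
    show "r \<le> m g" if "(g, r) \<in> G" for g r
      using m(2) cone_shift_uminus[OF p G that] minus[of g] by (auto simp: le_fun_def dest: spec[of _ "- g"])
  qed
qed

end

section \<open>Norming and separating functionals on normed spaces\<close>

lemma sublinear_norm: "sublinear scaleR (norm :: 'e::real_normed_vector \<Rightarrow> real)"
  by (simp add: sublinear_def norm_triangle_ineq)

lemma Hahn_Banach_norm:
  fixes G :: "('e::real_normed_vector \<times> real) set"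
  assumes "dominated_cone scaleR norm G"
  obtains j :: "'e \<Rightarrow>\<^sub>L real" where "norm j \<le> 1" "\<And>g r. (g, r) \<in> G \<Longrightarrow> r \<le> blinfun_apply j g"
proof -
  interpret real_vector_space "scaleR :: real \<Rightarrow> 'e \<Rightarrow> 'e"
    by unfold_locales (simp_all add: algebra_simps)
  obtain f where f: "\<And>x y. f (x + y) = f x + f y" "\<And>t x. f (t *\<^sub>R x) = t * f x"
    "\<And>x. f x \<le> norm x" "\<And>g r. (g, r) \<in> G \<Longrightarrow> r \<le> f g"
    using Hahn_Banach_cone[OF sublinear_norm assms] by blast
  have abs: "\<bar>f x\<bar> \<le> norm x" for x
    using f(3)[of x] f(3)[of "- x"] f(2)[of "-1" x] by simp
  have bl: "bounded_linear f"
    by (rule bounded_linear_intro[where K = 1]) (use f abs in auto)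
  show thesis
  proof (rule that[of "Blinfun f"])
    show "norm (Blinfun f) \<le> 1"
      by (rule norm_blinfun_bound) (use abs bl in \<open>auto simp: bounded_linear_Blinfun_apply\<close>)
    show "r \<le> blinfun_apply (Blinfun f) g" if "(g, r) \<in> G" for g r
      using f(4)[OF that] bl by (simp add: bounded_linear_Blinfun_apply)
  qed
qed

text \<open>The cone is the ray through \<open>x\<close>, with the norm as prescribed lower
  bound.\<close>

lemma norming_functional:
  fixes x :: "'e::real_normed_vector"
  obtains j :: "'e \<Rightarrow>\<^sub>L real" where "norm j \<le> 1" "blinfun_apply j x = norm x"
proof -
  define G where "G = {(t *\<^sub>R x, t * norm x) | t. t \<ge> 0}"
  have "dominated_cone scaleR norm G"
    unfolding dominated_cone_def
  proof (intro conjI allI impI)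
    show "(0, 0) \<in> G" unfolding G_def by (auto intro!: exI[of _ 0])
    show "(g + h, r + s) \<in> G" if gh: "(g, r) \<in> G" "(h, s) \<in> G" for g r h s
    proof -
      obtain t u where "t \<ge> 0" "u \<ge> 0" "g = t *\<^sub>R x" "r = t * norm x" "h = u *\<^sub>R x" "s = u * norm x"
        using gh by (auto simp: G_def)
      then show ?thesis unfolding G_def by (auto intro!: exI[of _ "t + u"] simp: algebra_simps)
    qed
    show "(t *\<^sub>R g, t * r) \<in> G" if "t > 0" "(g, r) \<in> G" for g r t
    proof -
      from that obtain u where "u \<ge> 0" "g = u *\<^sub>R x" "r = u * norm x" by (auto simp: G_def)
      then show ?thesis unfolding G_def using that(1) by (auto intro!: exI[of _ "t * u"])
    qed
    show "r \<le> norm g" if "(g, r) \<in> G" for g r using that by (auto simp: G_def)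
  qed
  then obtain j :: "'e \<Rightarrow>\<^sub>L real" where j: "norm j \<le> 1" "\<And>g r. (g, r) \<in> G \<Longrightarrow> r \<le> blinfun_apply j g"
    by (rule Hahn_Banach_norm) blast
  have "(x, norm x) \<in> G" unfolding G_def by (auto intro!: exI[of _ 1])
  then have "norm x \<le> blinfun_apply j x" by (rule j(2))
  moreover have "blinfun_apply j x \<le> norm x"
    using norm_blinfun[of j x] mult_right_mono[OF j(1) norm_ge_zero[of x]] by simp
  ultimately show thesis using that j(1) by force
qed

lemma functional_separates_points:
  fixes x y :: "'e::real_normed_vector"
  assumes "\<And>j :: 'e \<Rightarrow>\<^sub>L real. blinfun_apply j x = blinfun_apply j y"
  shows "x = y"
proof -
  obtain j :: "'e \<Rightarrow>\<^sub>L real" where "norm j \<le> 1" "blinfun_apply j (x - y) = norm (x - y)"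
    by (rule norming_functional)
  then show ?thesis using assms[of j] by (simp add: blinfun.diff_right)
qed

text \<open>The cone is generated by the pairs \<open>(z - c, d)\<close>; convexity of
  \<open>C\<close> is what makes it closed under addition.\<close>

lemma convex_separation:
  fixes C :: "'e::real_normed_vector set"
  assumes C: "convex C" "C \<noteq> {}" and d: "\<And>c. c \<in> C \<Longrightarrow> d \<le> norm (z - c)"
  obtains j :: "'e \<Rightarrow>\<^sub>L real" where "\<And>c. c \<in> C \<Longrightarrow> d \<le> blinfun_apply j (z - c)"
proof -
  define G where "G = {(t *\<^sub>R (z - c), t * d) | t c. t \<ge> 0 \<and> c \<in> C}"
  obtain c0 where c0: "c0 \<in> C" using C by blast
  have "dominated_cone scaleR norm G"
    unfolding dominated_cone_def
  proof (intro conjI allI impI)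
    show "(0, 0) \<in> G" unfolding G_def using c0 by (auto intro!: exI[of _ "0::real"] exI[of _ c0])
    show "(g + h, r + s) \<in> G" if gh: "(g, r) \<in> G" "(h, s) \<in> G" for g r h s
    proof -
      obtain t u a b where tu: "t \<ge> 0" "u \<ge> 0" and gr: "g = t *\<^sub>R (z - a)" "r = t * d" "a \<in> C"
        "h = u *\<^sub>R (z - b)" "s = u * d" "b \<in> C"
        using gh by (auto simp: G_def)
      show ?thesis
      proof (cases "t + u = 0")
        case True
        then have "t = 0" "u = 0" using tu by auto
        then show ?thesis unfolding G_def using gr by (auto intro!: exI[of _ "0::real"] exI[of _ a])
      next
        case False
        \<comment> \<open>The weights are chosen so that
          \<open>t *\<^sub>R (z - a) + u *\<^sub>R (z - b)\<close> becomes a single multiple of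
          \<open>z - c\<close>.\<close>
        define c where "c = (t / (t + u)) *\<^sub>R a + (u / (t + u)) *\<^sub>R b"
        have "c \<in> C" unfolding c_def
          using tu False gr(3,6) by (intro convexD[OF C(1)]) (auto simp flip: add_divide_distrib)
        moreover have "(t + u) *\<^sub>R c = t *\<^sub>R a + u *\<^sub>R b"
          using False by (simp add: c_def scaleR_add_right)
        then have "g + h = (t + u) *\<^sub>R (z - c)" by (simp add: gr algebra_simps)
        moreover have "r + s = (t + u) * d" by (simp add: gr distrib_right)
        ultimately show ?thesis unfolding G_def
          using tu by (simp only: mem_Collect_eq) (intro exI[of _ "t + u"] exI[of _ c], simp)
      qed
    qed
    show "(t *\<^sub>R g, t * r) \<in> G" if "t > 0" "(g, r) \<in> G" for g r t
    proof -
      from that obtain u c where "u \<ge> 0" "c \<in> C" "g = u *\<^sub>R (z - c)" "r = u * d" by (auto simp: G_def)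
      then show ?thesis unfolding G_def
        using that by (auto intro!: exI[of _ "t * u"] exI[of _ c])
    qed
    show "r \<le> norm g" if "(g, r) \<in> G" for g r
      using that d by (auto simp: G_def intro!: mult_left_mono)
  qed
  then obtain j :: "'e \<Rightarrow>\<^sub>L real" where j: "norm j \<le> 1" "\<And>g r. (g, r) \<in> G \<Longrightarrow> r \<le> blinfun_apply j g"
    by (rule Hahn_Banach_norm) blast
  show thesis
  proof (rule that[of j])
    fix c assume "c \<in> C"
    then have "(z - c, d) \<in> G" unfolding G_def by (auto intro!: exI[of _ 1] exI[of _ c])
    then show "d \<le> blinfun_apply j (z - c)" by (rule j(2))
  qed
qed

section \<open>Means and mean operators\<close>

lemma supnorm_upper:
  assumes "bounded_fun h" shows "\<bar>h t\<bar> \<le> supnorm h"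
proof -
  obtain M where "\<And>t. \<bar>h t\<bar> \<le> M" using assms by (auto simp: bounded_fun_def)
  then have "bdd_above (range (\<lambda>t. \<bar>h t\<bar>))" by (intro bdd_aboveI[of _ M]) auto
  then show ?thesis unfolding supnorm_def by (intro cSUP_upper) auto
qed

lemma supnorm_least: "(\<And>t. \<bar>h t\<bar> \<le> M) \<Longrightarrow> supnorm h \<le> M"
  unfolding supnorm_def by (intro cSUP_least) auto

text \<open>The a priori bound \<open>M\<close> makes the supremum in \<open>fnorm\<close> one of a
  bounded set, and it also settles the case \<open>supnorm h = 0\<close>, where \<open>h\<close>
  cannot be normalised.\<close>

lemma abs_le_fnorm:
  assumes X: "subspace_B X" and scale: "\<And>c h. h \<in> X \<Longrightarrow> \<phi> (\<lambda>t. c * h t) = c * \<phi> h"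
    and M: "\<And>h. h \<in> X \<Longrightarrow> \<bar>\<phi> h\<bar> \<le> M * supnorm h" and h: "h \<in> X"
  shows "\<bar>\<phi> h\<bar> \<le> fnorm X \<phi> * supnorm h"
proof -
  have bh: "bounded_fun h" using X h by (auto simp: subspace_B_def)
  \<comment> \<open>Here \<open>undefined\<close> is merely some point of the nonempty type:
    \<open>supnorm h\<close> dominates an absolute value.\<close>
  have nn: "0 \<le> supnorm h" using supnorm_upper[OF bh, of undefined] by simp
  show ?thesis
  proof (cases "supnorm h = 0")
    case True
    then show ?thesis using M[OF h] by simp
  next
    case False
    then have pos: "supnorm h > 0" using nn by simp
    define k where "k = (\<lambda>t. inverse (supnorm h) * h t)"
    have k: "k \<in> X" using X h by (auto simp: subspace_B_def k_def)
    have "supnorm k \<le> 1"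
    proof (rule supnorm_least)
      show "\<bar>k t\<bar> \<le> 1" for t
        using supnorm_upper[OF bh, of t] pos by (simp add: k_def abs_mult field_simps)
    qed
    moreover have "\<bar>\<phi> g\<bar> \<le> \<bar>M\<bar>" if "g \<in> X" "supnorm g \<le> 1" for g
    proof -
      have "bounded_fun g" using X that by (auto simp: subspace_B_def)
      then have "0 \<le> supnorm g" using supnorm_upper[of g undefined] by simp
      then have "M * supnorm g \<le> \<bar>M\<bar> * 1" using that by (intro mult_mono) auto
      then show ?thesis using M[OF that(1)] by simp
    qed
    then have "bdd_above {\<bar>\<phi> h\<bar> | h. h \<in> X \<and> supnorm h \<le> 1}"
      by (intro bdd_aboveI[of _ "\<bar>M\<bar>"]) auto
    ultimately have "\<bar>\<phi> k\<bar> \<le> fnorm X \<phi>"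
      unfolding fnorm_def using k by (intro cSup_upper) auto
    also have "\<phi> k = inverse (supnorm h) * \<phi> h" unfolding k_def by (rule scale[OF h])
    finally show ?thesis using pos by (simp add: abs_mult field_simps)
  qed
qed

lemma subspace_B_add: "subspace_B X \<Longrightarrow> h \<in> X \<Longrightarrow> k \<in> X \<Longrightarrow> (\<lambda>t. h t + k t) \<in> X"
  by (simp add: subspace_B_def)

lemma subspace_B_scale: "subspace_B X \<Longrightarrow> h \<in> X \<Longrightarrow> (\<lambda>t. c * h t) \<in> X"
  by (simp add: subspace_B_def)

lemma subspace_B_diff: "subspace_B X \<Longrightarrow> h \<in> X \<Longrightarrow> k \<in> X \<Longrightarrow> (\<lambda>t. h t - k t) \<in> X"
  using subspace_B_add[OF _ _ subspace_B_scale[where c = "-1"], of X h k] by simp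

lemma mean_add: "mean_on X m \<Longrightarrow> h \<in> X \<Longrightarrow> k \<in> X \<Longrightarrow> m (\<lambda>t. h t + k t) = m h + m k"
  by (simp add: mean_on_def bounded_functional_def linear_on_X_def)

lemma mean_scale: "mean_on X m \<Longrightarrow> h \<in> X \<Longrightarrow> m (\<lambda>t. c * h t) = c * m h"
  by (simp add: mean_on_def bounded_functional_def linear_on_X_def)

lemma mean_abs_le:
  assumes X: "subspace_B X" and m: "mean_on X m" and h: "h \<in> X"
  shows "\<bar>m h\<bar> \<le> supnorm h"
proof -
  obtain M where "\<And>h. h \<in> X \<Longrightarrow> \<bar>m h\<bar> \<le> M * supnorm h"
    using m unfolding mean_on_def bounded_functional_def by blast
  from abs_le_fnorm[of X m M h, OF X mean_scale[OF m] this h]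
  show ?thesis using m by (simp add: mean_on_def)
qed

lemma mean_diff:
  assumes X: "subspace_B X" and m: "mean_on X m" and h: "h \<in> X" and k: "k \<in> X"
  shows "m (\<lambda>t. h t - k t) = m h - m k"
proof -
  have "(\<lambda>t. -1 * k t) \<in> X" by (rule subspace_B_scale[OF X k])
  from mean_add[OF m h this] mean_scale[OF m k, of "-1"] show ?thesis by simp
qed

text \<open>Norm one and value one at the constant 1 give monotonicity: \<open>h\<close> takes
  values in \<open>[b, c]\<close>, so after subtracting the midpoint \<open>e\<close> its sup norm
  is at most half the length of that interval.\<close>

lemma mean_le:
  assumes X: "subspace_B X" and one: "(\<lambda>_. 1) \<in> X" and m: "mean_on X m"
    and h: "h \<in> X" and c: "\<And>t. h t \<le> c"
  shows "m h \<le> c"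
proof -
  define b where "b = - supnorm h"
  have b: "b \<le> h t" for t
    using supnorm_upper[of h t] X h by (auto simp: subspace_B_def b_def)
  define e where "e = (b + c) / 2"
  have cst: "(\<lambda>t. e * 1) \<in> X" by (rule subspace_B_scale[OF X one])
  have "(\<lambda>t. h t - e) \<in> X" using subspace_B_diff[OF X h cst] by simp
  from mean_abs_le[OF X m this] have "\<bar>m (\<lambda>t. h t - e)\<bar> \<le> supnorm (\<lambda>t. h t - e)" .
  also have "\<dots> \<le> (c - b) / 2"
  proof (rule supnorm_least)
    show "\<bar>h t - e\<bar> \<le> (c - b) / 2" for t
      using b[of t] c[of t] by (simp add: e_def abs_le_iff field_simps)
  qed
  also have "m (\<lambda>t. h t - e) = m h - e"
    using mean_diff[OF X m h cst] mean_scale[OF m one, of e] m by (simp add: mean_on_def)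
  finally show ?thesis by (simp add: e_def abs_le_iff field_simps)
qed

text \<open>Norm convergence is turned into convergence at each \<open>h\<close>; the factor 2
  arises because the functional is a difference of two functionals of norm at most one.\<close>

lemma left_regular_tendsto:
  assumes X: "subspace_B X" and inv: "left_invariant X" and reg: "left_regular X \<mu>" and h: "h \<in> X"
  shows "(\<lambda>n. \<mu> n (left_translate s h) - \<mu> n h) \<longlonglongrightarrow> 0"
proof (rule Lim_null_comparison)
  let ?\<phi> = "\<lambda>n h. \<mu> n (left_translate s h) - \<mu> n h"
  have tr: "left_translate s k \<in> X" if "k \<in> X" for k
    using inv that by (auto simp: left_invariant_def)
  have m: "mean_on X (\<mu> n)" for n using reg by (simp add: left_regular_def)
  have "\<bar>?\<phi> n h\<bar> \<le> fnorm X (?\<phi> n) * supnorm h" for n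
  proof (rule abs_le_fnorm[OF X _ _ h])
    show "?\<phi> n (\<lambda>t. c * k t) = c * ?\<phi> n k" if "k \<in> X" for c k
      using mean_scale[OF m that] mean_scale[OF m tr[OF that], of n c]
      by (simp add: left_translate_def algebra_simps)
    show "\<bar>?\<phi> n k\<bar> \<le> 2 * supnorm k" if k: "k \<in> X" for k
    proof -
      have "bounded_fun k" using X k by (auto simp: subspace_B_def)
      then have "supnorm (left_translate s k) \<le> supnorm k"
        by (intro supnorm_least) (auto simp: left_translate_def supnorm_upper)
      then show ?thesis using mean_abs_le[OF X m k, of n] mean_abs_le[OF X m tr[OF k], of n] by linarith
    qed
  qed
  then show "\<forall>\<^sub>F n in sequentially. norm (?\<phi> n h) \<le> fnorm X (?\<phi> n) * supnorm h" by simp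
  have "(\<lambda>n. fnorm X (?\<phi> n)) \<longlonglongrightarrow> 0" using reg by (simp add: left_regular_def)
  from tendsto_mult_left_zero[OF this]
  show "(\<lambda>n. fnorm X (?\<phi> n) * supnorm h) \<longlonglongrightarrow> 0" .
qed

section \<open>Mean operators of one representation on a compact convex set\<close>

locale compact_action =
  fixes C :: "'e::banach set"
    and T :: "'s::semigroup_mult \<Rightarrow> 'e \<Rightarrow> 'e"
    and X :: "('s \<Rightarrow> real) set"
  assumes reflexive: "reflexive_space TYPE('e)"
    and nonempty: "C \<noteq> {}"
    and compact: "compact C"
    and convex: "convex C"
    and rep: "nonexpansive_representation C T"
    and subspace: "subspace_B X"
    and invariant: "left_invariant X"
    and one: "(\<lambda>_. 1) \<in> X"
    and orbit: "x \<in> C \<Longrightarrow> (\<lambda>t. blinfun_apply (j :: 'e \<Rightarrow>\<^sub>L real) (T t x)) \<in> X"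
begin

lemma T_in: "x \<in> C \<Longrightarrow> T s x \<in> C"
  using rep by (auto simp: nonexpansive_representation_def)

lemma T_nonexpansive: "x \<in> C \<Longrightarrow> y \<in> C \<Longrightarrow> norm (T s x - T s y) \<le> norm (x - y)"
  using rep by (auto simp: nonexpansive_representation_def nonexpansive_on_def)

lemma T_mult: "x \<in> C \<Longrightarrow> T (s * t) x = T s (T t x)"
  using rep by (auto simp: nonexpansive_representation_def)

text \<open>Averaging the orbit defines a bounded functional on the dual space. Reflexivity
  represents it by a point, and this point is unique because functionals separate points, so the
  description in \<open>T_mean\<close> is proper.\<close>

lemma T_mean_apply:
  fixes j :: "'e \<Rightarrow>\<^sub>L real"
  assumes m: "mean_on X m" and x: "x \<in> C"
  shows "blinfun_apply j (T_mean m T x) = m (\<lambda>t. blinfun_apply j (T t x))"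
proof -
  obtain B where B: "\<And>y. y \<in> C \<Longrightarrow> norm y \<le> B"
    using compact_imp_bounded[OF compact] by (auto simp: bounded_iff)
  define \<phi> where "\<phi> = (\<lambda>j :: 'e \<Rightarrow>\<^sub>L real. m (\<lambda>t. blinfun_apply j (T t x)))"
  have "bounded_linear \<phi>"
  proof (rule bounded_linear_intro[where K = B])
    show "\<phi> (j + k) = \<phi> j + \<phi> k" for j k
      unfolding \<phi>_def using mean_add[OF m orbit[OF x] orbit[OF x]] by (simp add: blinfun.add_left)
    show "\<phi> (c *\<^sub>R j) = c *\<^sub>R \<phi> j" for c j
      unfolding \<phi>_def using mean_scale[OF m orbit[OF x]] by (simp add: blinfun.scaleR_left)
    show "norm (\<phi> j) \<le> norm j * B" for j
    proof -
      have "\<bar>\<phi> j\<bar> \<le> supnorm (\<lambda>t. blinfun_apply j (T t x))"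
        unfolding \<phi>_def by (rule mean_abs_le[OF subspace m orbit[OF x]])
      also have "\<dots> \<le> norm j * B"
      proof (rule supnorm_least)
        fix t
        have "\<bar>blinfun_apply j (T t x)\<bar> \<le> norm j * norm (T t x)" using norm_blinfun[of j "T t x"] by simp
        also have "\<dots> \<le> norm j * B" by (intro mult_left_mono B T_in x) simp
        finally show "\<bar>blinfun_apply j (T t x)\<bar> \<le> norm j * B" .
      qed
      finally show ?thesis by simp
    qed
  qed
  then have app: "blinfun_apply (Blinfun \<phi>) = \<phi>" by (rule bounded_linear_Blinfun_apply)
  obtain y where "\<And>j. blinfun_apply (Blinfun \<phi>) j = blinfun_apply j y"
    using reflexive unfolding reflexive_space_def by blast
  then have y: "\<forall>j. blinfun_apply j y = m (\<lambda>t. blinfun_apply j (T t x))"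
    unfolding app by (simp add: \<phi>_def)
  have "T_mean m T x = y"
    unfolding T_mean_def
    by (rule the_equality) (use y in \<open>auto intro: functional_separates_points\<close>)
  then show ?thesis using y by simp
qed

text \<open>A point outside \<open>C\<close> has positive distance from it. A separating functional
  bounds the whole orbit away from that point, and the mean respects the bound.\<close>

lemma T_mean_in:
  assumes m: "mean_on X m" and x: "x \<in> C"
  shows "T_mean m T x \<in> C"
proof (rule ccontr)
  let ?y = "T_mean m T x"
  assume "?y \<notin> C"
  then have d: "infdist ?y C > 0"
    using infdist_pos_not_in_closed[OF compact_imp_closed[OF compact] nonempty] by simp
  have "infdist ?y C \<le> norm (?y - c)" if "c \<in> C" for c
    using infdist_le[OF that, of ?y] by (simp add: dist_norm)
  then obtain j :: "'e \<Rightarrow>\<^sub>L real"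
    where j: "\<And>c. c \<in> C \<Longrightarrow> infdist ?y C \<le> blinfun_apply j (?y - c)"
    by (rule convex_separation[OF convex nonempty]) blast+
  have "blinfun_apply j (T t x) \<le> blinfun_apply j ?y - infdist ?y C" for t
    using j[OF T_in[OF x], of t] by (simp add: blinfun.diff_right)
  then have "m (\<lambda>t. blinfun_apply j (T t x)) \<le> blinfun_apply j ?y - infdist ?y C"
    by (rule mean_le[OF subspace one m orbit[OF x]])
  then show False using d T_mean_apply[OF m x, of j] by simp
qed

text \<open>A norming functional of the difference reduces the claim to averaging a real function
  bounded by \<open>norm (x - y)\<close>.\<close>

lemma T_mean_nonexpansive:
  assumes m: "mean_on X m" and x: "x \<in> C" and y: "y \<in> C"
  shows "norm (T_mean m T x - T_mean m T y) \<le> norm (x - y)"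
proof -
  obtain j :: "'e \<Rightarrow>\<^sub>L real" where j: "norm j \<le> 1"
    "blinfun_apply j (T_mean m T x - T_mean m T y) = norm (T_mean m T x - T_mean m T y)"
    by (rule norming_functional)
  have "norm (T_mean m T x - T_mean m T y)
      = m (\<lambda>t. blinfun_apply j (T t x) - blinfun_apply j (T t y))"
    using j(2) mean_diff[OF subspace m orbit[OF x] orbit[OF y]] T_mean_apply[OF m x, of j] T_mean_apply[OF m y, of j]
    by (simp add: blinfun.diff_right)
  also have "\<dots> \<le> norm (x - y)"
  proof (rule mean_le[OF subspace one m])
    show "(\<lambda>t. blinfun_apply j (T t x) - blinfun_apply j (T t y)) \<in> X"
      by (rule subspace_B_diff[OF subspace orbit[OF x] orbit[OF y]])
    fix t
    have "blinfun_apply j (T t x) - blinfun_apply j (T t y) \<le> norm j * norm (T t x - T t y)"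
      using norm_blinfun[of j "T t x - T t y"] by (simp add: blinfun.diff_right)
    also have "\<dots> \<le> 1 * norm (x - y)" by (intro mult_mono j T_nonexpansive x y) auto
    finally show "blinfun_apply j (T t x) - blinfun_apply j (T t y) \<le> norm (x - y)" by simp
  qed
  finally show ?thesis .
qed

lemma T_mean_fixed:
  assumes m: "mean_on X m" and p: "p \<in> Fix_rep C T"
  shows "T_mean m T p = p"
proof (rule functional_separates_points)
  fix j :: "'e \<Rightarrow>\<^sub>L real"
  have "p \<in> C" "\<And>t. T t p = p" using p by (auto simp: Fix_rep_def)
  moreover have "m (\<lambda>_. c) = c" for c
    using mean_scale[OF m one, of c] m by (simp add: mean_on_def)
  ultimately show "blinfun_apply j (T_mean m T p) = blinfun_apply j p"
    using T_mean_apply[OF m, of p j] by simp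
qed

end

section \<open>Strict convexity\<close>

text \<open>The definition concerns midpoints only. For \<open>l \<le> 1/2\<close> the point lies
  between the midpoint, of norm less than one, and \<open>y\<close>; the other case follows by
  exchanging \<open>x\<close> and \<open>y\<close>.\<close>

lemma strict_convexity_segment:
  fixes x y :: "'e::real_normed_vector"
  assumes sc: "strictly_convex_space TYPE('e)" and nx: "norm x = 1" and ny: "norm y = 1"
    and l: "0 < l" "l < 1" and eq: "norm (l *\<^sub>R x + (1 - l) *\<^sub>R y) = 1"
  shows "x = y"
proof -
  have half: "x = y" if l: "0 < l" "l \<le> 1/2" and nx: "norm x = 1" and ny: "norm y = 1"
    and eq: "norm (l *\<^sub>R x + (1 - l) *\<^sub>R y) = 1" for l :: real and x y :: 'e
  proof (rule ccontr)
    assume "x \<noteq> y"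
    then have mid: "norm ((1/2) *\<^sub>R (x + y)) < 1" using sc nx ny unfolding strictly_convex_space_def by blast
    have "l *\<^sub>R x + (1 - l) *\<^sub>R y = (2 * l) *\<^sub>R ((1/2) *\<^sub>R (x + y)) + (1 - 2 * l) *\<^sub>R y"
      by (simp add: algebra_simps flip: scaleR_add_left)
    also have "norm \<dots> \<le> 2 * l * norm ((1/2) *\<^sub>R (x + y)) + (1 - 2 * l)"
      using norm_triangle_ineq[of "(2 * l) *\<^sub>R ((1/2) *\<^sub>R (x + y))" "(1 - 2 * l) *\<^sub>R y"] l ny by simp
    also have "\<dots> < 1" using mult_strict_left_mono[OF mid, of "2 * l"] l by simp
    finally show False using eq by simp
  qed
  show ?thesis
  proof (cases "l \<le> 1/2")
    case True
    then show ?thesis using half[OF l(1) True nx ny eq] by simp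
  next
    case False
    then show ?thesis using half[of "1 - l" y x] l nx ny eq by (simp add: add.commute)
  qed
qed

text \<open>The bounds force equality in the triangle inequality, so the normalised \<open>a\<close>
  and \<open>b\<close> are unit vectors with a convex combination of norm one and hence
  coincide.\<close>

lemma strict_convexity_triangle:
  fixes a b :: "'e::real_normed_vector"
  assumes sc: "strictly_convex_space TYPE('e)" and l: "0 < l" "l < 1"
    and a: "norm a \<le> l * norm (a + b)" and b: "norm b \<le> (1 - l) * norm (a + b)"
  shows "a = l *\<^sub>R (a + b)"
proof (cases "a + b = 0")
  case True
  then show ?thesis using a by simp
next
  case False
  define r where "r = norm (a + b)"
  have r: "r > 0" using False by (simp add: r_def)
  have "r \<le> norm a + norm b" unfolding r_def by (rule norm_triangle_ineq)
  then have na: "norm a = l * r" and nb: "norm b = (1 - l) * r"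
    using a b by (simp_all add: r_def[symmetric] algebra_simps)
  define x where "x = (1 / (l * r)) *\<^sub>R a"
  define y where "y = (1 / ((1 - l) * r)) *\<^sub>R b"
  have "l *\<^sub>R x + (1 - l) *\<^sub>R y = (1 / r) *\<^sub>R (a + b)"
    using l r by (simp add: x_def y_def scaleR_add_right)
  then have "norm (l *\<^sub>R x + (1 - l) *\<^sub>R y) = 1" using r by (simp add: r_def)
  then have "x = y"
    by (intro strict_convexity_segment[OF sc _ _ l]) (use l r na nb in \<open>auto simp: x_def y_def\<close>)
  then have "(1 / r) *\<^sub>R (a + b) = x"
    using \<open>l *\<^sub>R x + (1 - l) *\<^sub>R y = _\<close> by (simp flip: scaleR_add_left)
  then have "(l * r) *\<^sub>R ((1 / r) *\<^sub>R (a + b)) = (l * r) *\<^sub>R x" by simp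
  then show ?thesis using l r by (simp add: x_def)
qed

text \<open>The distances of \<open>F z\<close> to the images of the endpoints are at most the
  proportional parts of their distance, and strict convexity leaves only one such point.\<close>

lemma nonexpansive_affine_segment:
  fixes F :: "'e::real_normed_vector \<Rightarrow> 'e"
  assumes sc: "strictly_convex_space TYPE('e)" and C: "convex C" and F: "nonexpansive_on C F"
    and x: "x \<in> C" and y: "y \<in> C" and iso: "norm (F x - F y) = norm (x - y)"
    and l: "0 \<le> l" "l \<le> 1"
  shows "F ((1 - l) *\<^sub>R x + l *\<^sub>R y) = (1 - l) *\<^sub>R F x + l *\<^sub>R F y"
proof (cases "l = 0 \<or> l = 1")
  case True
  then show ?thesis by auto
next
  case False
  then have l: "0 < l" "l < 1" using l by auto
  define z where "z = (1 - l) *\<^sub>R x + l *\<^sub>R y"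
  have z: "z \<in> C" unfolding z_def using convexD[OF C x y, of "1 - l" l] l by simp
  have "x - z = l *\<^sub>R (x - y)" "z - y = (1 - l) *\<^sub>R (x - y)" by (simp_all add: z_def algebra_simps)
  then have "norm (x - z) = l * norm (x - y)" "norm (z - y) = (1 - l) * norm (x - y)"
    using l by simp_all
  then have "norm (F x - F z) \<le> l * norm (x - y)" "norm (F z - F y) \<le> (1 - l) * norm (x - y)"
    using F x y z unfolding nonexpansive_on_def by metis+
  then have "F x - F z = l *\<^sub>R (F x - F z + (F z - F y))"
    by (intro strict_convexity_triangle[OF sc l]) (simp_all add: iso)
  then have "F z = F x - l *\<^sub>R (F x - F y)" by (simp add: algebra_simps)
  then show ?thesis by (simp add: z_def algebra_simps)
qed

text \<open>Bruck's induction: pull all points towards the last one.  The shrunken points are again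
  isometrically mapped, and the segment case computes their images.\<close>

lemma nonexpansive_affine:
  fixes F :: "'e::real_normed_vector \<Rightarrow> 'e" and w :: "'j \<Rightarrow> 'e"
  assumes sc: "strictly_convex_space TYPE('e)" and C: "convex C" and F: "nonexpansive_on C F"
    and J: "finite J" and w: "\<And>j. j \<in> J \<Longrightarrow> w j \<in> C"
    and iso: "\<And>j k. j \<in> J \<Longrightarrow> k \<in> J \<Longrightarrow> norm (F (w j) - F (w k)) = norm (w j - w k)"
    and c: "\<And>j. j \<in> J \<Longrightarrow> 0 \<le> c j" "sum c J = 1"
  shows "F (\<Sum>j\<in>J. c j *\<^sub>R w j) = (\<Sum>j\<in>J. c j *\<^sub>R F (w j))"
  using J w iso c
proof (induction J arbitrary: w c rule: finite_induct)
  case empty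
  then show ?case by simp
next
  case (insert a J)
  have sum: "c a + sum c J = 1" using insert.prems(4) insert.hyps by simp
  have nn: "0 \<le> sum c J" using insert.prems(3) by (intro sum_nonneg) auto
  have ca: "0 \<le> c a" "c a \<le> 1" using sum nn insert.prems(3)[of a] by auto
  show ?case
  proof (cases "c a = 1")
    case True
    then have "sum c J = 0" using sum by simp
    then have "\<forall>j\<in>J. c j = 0"
      using sum_nonneg_eq_0_iff[OF insert.hyps(1), of c] insert.prems(3) by auto
    then show ?thesis using insert.hyps True by simp
  next
    case False
    define u where "u j = (1 - c a) *\<^sub>R w j + c a *\<^sub>R w a" for j
    \<comment> \<open>Dividing the remaining weights by \<open>1 - c a\<close> makes them sum to one
      and cancels the contraction factor in \<open>u\<close>.\<close>
    define b where "b j = c j / (1 - c a)" for j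
    have pos: "1 - c a > 0" using ca False by simp
    have Fu: "F (u j) = (1 - c a) *\<^sub>R F (w j) + c a *\<^sub>R F (w a)" if "j \<in> J" for j
      unfolding u_def using that insert.prems ca by (intro nonexpansive_affine_segment[OF sc C F]) auto
    have sumb: "sum b J = 1" using sum pos by (simp add: b_def field_simps flip: sum_divide_distrib)
    have "F (\<Sum>j\<in>J. b j *\<^sub>R u j) = (\<Sum>j\<in>J. b j *\<^sub>R F (u j))"
    proof (rule insert.IH)
      show "u j \<in> C" if "j \<in> J" for j
        unfolding u_def using that insert.prems(1) ca by (intro convexD[OF C]) auto
      show "norm (F (u j) - F (u k)) = norm (u j - u k)" if "j \<in> J" "k \<in> J" for j k
      proof -
        have "F (u j) - F (u k) = (1 - c a) *\<^sub>R (F (w j) - F (w k))"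
          using that by (simp add: Fu algebra_simps)
        moreover have "u j - u k = (1 - c a) *\<^sub>R (w j - w k)" by (simp add: u_def algebra_simps)
        ultimately show ?thesis using insert.prems(2)[of j k] that by simp
      qed
      show "0 \<le> b j" if "j \<in> J" for j using insert.prems(3)[of j] that pos by (simp add: b_def)
      show "sum b J = 1" by (rule sumb)
    qed
    \<comment> \<open>Stated for arbitrary \<open>v\<close>, the identity serves both for the points
      \<open>w\<close> and for their images under \<open>F\<close>.\<close>
    moreover have "(\<Sum>j\<in>J. b j *\<^sub>R ((1 - c a) *\<^sub>R v j + c a *\<^sub>R v a)) = (\<Sum>j\<in>insert a J. c j *\<^sub>R v j)"
      for v :: "'j \<Rightarrow> 'e"
    proof -
      have "(\<Sum>j\<in>J. b j *\<^sub>R ((1 - c a) *\<^sub>R v j + c a *\<^sub>R v a))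
          = (\<Sum>j\<in>J. c j *\<^sub>R v j + b j *\<^sub>R (c a *\<^sub>R v a))"
        using pos by (intro sum.cong) (simp_all add: b_def scaleR_add_right)
      also have "\<dots> = (\<Sum>j\<in>J. c j *\<^sub>R v j) + c a *\<^sub>R v a"
        using sumb by (simp add: sum.distrib flip: scaleR_sum_left sum_distrib_right)
      finally show ?thesis using insert.hyps by (simp add: add.commute)
    qed
    moreover have "(\<Sum>j\<in>J. b j *\<^sub>R F (u j)) = (\<Sum>j\<in>J. b j *\<^sub>R ((1 - c a) *\<^sub>R F (w j) + c a *\<^sub>R F (w a)))"
      using Fu by (intro sum.cong) auto
    ultimately show ?thesis by (simp add: u_def)
  qed
qed

section \<open>Limits of invariant averages are fixed points\<close>

text \<open>One further extraction per index; the limits already obtained survive passing to a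
  subsequence.\<close>

lemma finite_family_common_subsequence:
  fixes y :: "nat \<Rightarrow> 'j \<Rightarrow> 'e::metric_space"
  assumes C: "compact C" and J: "finite J" and y: "\<And>n j. j \<in> J \<Longrightarrow> y n j \<in> C"
  shows "\<exists>r w. strict_mono r \<and> (\<forall>j\<in>J. w j \<in> C \<and> (\<lambda>n. y (r n) j) \<longlonglongrightarrow> w j)"
  using J y
proof (induction J rule: finite_induct)
  case empty
  then show ?case by (auto intro!: exI[of _ id] simp: strict_mono_def)
next
  case (insert a J)
  then obtain r w where r: "strict_mono r"
    and w: "\<And>j. j \<in> J \<Longrightarrow> w j \<in> C" "\<And>j. j \<in> J \<Longrightarrow> (\<lambda>n. y (r n) j) \<longlonglongrightarrow> w j"
    by (metis insertCI)
  obtain l q where l: "l \<in> C" and q: "strict_mono q" and lim: "((\<lambda>n. y (r n) a) \<circ> q) \<longlonglongrightarrow> l"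
    using C insert.prems[of a] unfolding compact_def by (metis insertI1)
  have "strict_mono (\<lambda>n. r (q n))" using strict_mono_o[OF r q] by (simp add: o_def)
  moreover have "(\<lambda>n. y (r (q n)) j) \<longlonglongrightarrow> w j" if "j \<in> J" for j
    using LIMSEQ_subseq_LIMSEQ[OF w(2)[OF that] q] by (simp add: o_def)
  moreover have "(\<lambda>n. y (r (q n)) a) \<longlonglongrightarrow> l" using lim by (simp add: o_def)
  ultimately show ?case using l w(1) insert.hyps
    by (intro exI[of _ "\<lambda>n. r (q n)"] exI[of _ "w(a := l)"]) auto
qed

text \<open>Adds two combinations with different finite supports. With \<open>v\<close> constantly 1
  it also adds their total weights.\<close>

lemma sum_scaleR_union_weights:
  fixes v :: "'t \<Rightarrow> 'v::real_vector"
  assumes "finite J" "finite K"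
  shows "(\<Sum>t\<in>J \<union> K. ((if t \<in> J then c t else 0) + (if t \<in> K then d t else 0)) *\<^sub>R v t)
    = (\<Sum>t\<in>J. c t *\<^sub>R v t) + (\<Sum>t\<in>K. d t *\<^sub>R v t)"
proof -
  have "(\<Sum>t\<in>J \<union> K. (if t \<in> J then c t else 0) *\<^sub>R v t) = (\<Sum>t\<in>J. c t *\<^sub>R v t)"
    using assms by (intro sum.mono_neutral_cong_right) auto
  moreover have "(\<Sum>t\<in>J \<union> K. (if t \<in> K then d t else 0) *\<^sub>R v t) = (\<Sum>t\<in>K. d t *\<^sub>R v t)"
    using assms by (intro sum.mono_neutral_cong_right) auto
  ultimately show ?thesis by (simp only: scaleR_add_left sum.distrib)
qed

lemma subspace_B_sum:
  assumes X: "subspace_B X" and F: "finite F" and h: "\<And>s. s \<in> F \<Longrightarrow> h s \<in> X"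
  shows "(\<lambda>t. \<Sum>s\<in>F. h s t) \<in> X"
  using F h
proof (induction F rule: finite_induct)
  case empty
  then show ?case using X by (simp add: subspace_B_def)
next
  case (insert a F)
  then show ?case using subspace_B_add[OF X, of "h a" "\<lambda>t. \<Sum>s\<in>F. h s t"] by simp
qed

lemma mean_sum:
  assumes X: "subspace_B X" and m: "mean_on X m" and F: "finite F" and h: "\<And>s. s \<in> F \<Longrightarrow> h s \<in> X"
  shows "m (\<lambda>t. \<Sum>s\<in>F. h s t) = (\<Sum>s\<in>F. m (h s))"
  using F h
proof (induction F rule: finite_induct)
  case empty
  have "(\<lambda>_. 0) \<in> X" using X by (simp add: subspace_B_def)
  from mean_scale[OF m this, of 0] show ?case by simp
next
  case (insert a F)
  then have "(\<lambda>t. \<Sum>s\<in>F. h s t) \<in> X" by (intro subspace_B_sum[OF X]) auto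
  then show ?case using mean_add[OF m, of "h a" "\<lambda>t. \<Sum>s\<in>F. h s t"] insert by simp
qed

lemma mean_ge:
  assumes X: "subspace_B X" and one: "(\<lambda>_. 1) \<in> X" and m: "mean_on X m"
    and h: "h \<in> X" and c: "\<And>t. c \<le> h t"
  shows "c \<le> m h"
proof -
  have "m (\<lambda>t. -1 * h t) \<le> - c"
    by (rule mean_le[OF X one m subspace_B_scale[OF X h]]) (use c in simp)
  then show ?thesis using mean_scale[OF m h, of "-1"] by simp
qed

text \<open>The bound by norms over \<open>F\<close> makes \<open>f\<close> vanish on functions that
  are zero on \<open>F\<close>; the rest is a finite sum of functions supported at one coordinate,
  on each of which \<open>f\<close> is a bounded functional.\<close>

lemma product_functional_decomposition:
  fixes f :: "('s \<Rightarrow> 'e::real_normed_vector) \<Rightarrow> real"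
  assumes F: "finite F" and add: "\<And>g h. f (g + h) = f g + f h"
    and scale: "\<And>c h. f (\<lambda>s. c *\<^sub>R h s) = c * f h"
    and le: "\<And>h. f h \<le> (\<Sum>s\<in>F. norm (h s))"
  obtains j :: "'s \<Rightarrow> 'e \<Rightarrow>\<^sub>L real" where "\<And>h. f h = (\<Sum>s\<in>F. blinfun_apply (j s) (h s))"
proof -
  define g where "g s v = f (\<lambda>s'. if s' = s then v else 0)" for s v
  have minus: "f (\<lambda>s. - h s) = - f h" for h using scale[of "-1" h] by simp
  have bl: "bounded_linear (g s)" if s: "s \<in> F" for s
  proof (rule bounded_linear_intro[where K = 1])
    show "g s (v + w) = g s v + g s w" for v w
      unfolding g_def add[symmetric] by (rule arg_cong[where f = f]) auto
    show "g s (c *\<^sub>R v) = c *\<^sub>R g s v" for c v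
      unfolding g_def real_scaleR_def scale[symmetric] by (rule arg_cong[where f = f]) auto
    have "g s v \<le> norm v" for v
    proof -
      have "g s v \<le> (\<Sum>s'\<in>F. norm (if s' = s then v else 0))" unfolding g_def by (rule le)
      also have "\<dots> = (\<Sum>s'\<in>F. if s' = s then norm v else 0)" by (rule sum.cong) auto
      also have "\<dots> = norm v" using F s by simp
      finally show ?thesis .
    qed
    moreover have "- g s v = g s (- v)" for v
      unfolding g_def minus[symmetric] by (rule arg_cong[where f = f]) auto
    ultimately show "norm (g s v) \<le> norm v * 1" for v
      by (metis abs_le_iff mult.right_neutral norm_minus_cancel real_norm_def)
  qed
  have restrict: "f (\<lambda>s. if s \<in> A then h s else 0) = (\<Sum>s\<in>A. g s (h s))" if "finite A" for A h
    using that
  proof (induction A rule: finite_induct)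
    case empty
    show ?case using scale[of 0 h] by simp
  next
    case (insert a A)
    have "(\<lambda>s. if s \<in> insert a A then h s else 0)
        = (\<lambda>s. if s = a then h a else 0) + (\<lambda>s. if s \<in> A then h s else 0)"
      using insert.hyps by auto
    then show ?case using insert by (simp add: add g_def)
  qed
  have "f h = (\<Sum>s\<in>F. g s (h s))" for h
  proof -
    let ?k = "\<lambda>s. if s \<in> F then 0 else h s"
    have "f ?k \<le> 0" using le[of ?k] by simp
    moreover have "f (\<lambda>s. - ?k s) \<le> 0" using le[of "\<lambda>s. - ?k s"] by simp
    ultimately have "f ?k = 0" using minus[of ?k] by simp
    moreover have "f h = f ((\<lambda>s. if s \<in> F then h s else 0) + ?k)" by (rule arg_cong[where f = f]) auto
    ultimately show ?thesis by (simp only: add restrict[OF F] add_0_right)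
  qed
  then show thesis
    by (intro that[of "\<lambda>s. Blinfun (g s)"]) (simp add: bounded_linear_Blinfun_apply bl)
qed

context compact_action
begin

lemma T_tendsto:
  assumes a: "\<And>n. a n \<in> C" "a \<longlonglongrightarrow> w"
  shows "w \<in> C" "(\<lambda>n. T s (a n)) \<longlonglongrightarrow> T s w"
proof -
  show w: "w \<in> C" using closed_sequentially[OF compact_imp_closed[OF compact]] a by blast
  have "(\<lambda>n. norm (a n - w)) \<longlonglongrightarrow> 0" using a(2) by (simp add: LIM_zero tendsto_norm_zero)
  then have "(\<lambda>n. T s (a n) - T s w) \<longlonglongrightarrow> 0"
    by (rule Lim_null_comparison[rotated]) (simp add: T_nonexpansive a w)
  then show "(\<lambda>n. T s (a n)) \<longlonglongrightarrow> T s w" by (rule LIM_zero_cancel)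
qed

text \<open>Nonexpansive maps are determined up to a small error by their rounded values on a finite
  net \<open>K\<close> of \<open>C\<close>, and there are only finitely many maps from
  \<open>K\<close> to \<open>K\<close>.\<close>

lemma finite_uniform_net:
  assumes d: "d > 0"
  obtains F where "finite F" "\<And>s. \<exists>s'\<in>F. \<forall>x\<in>C. norm (T s x - T s' x) \<le> d"
proof -
  obtain K where K: "finite K" "K \<subseteq> C" "C \<subseteq> (\<Union>x\<in>K. ball x (d / 4))"
    using seq_compact_imp_totally_bounded[of C] compact d
    by (metis compact_eq_seq_compact_metric divide_pos_pos zero_less_numeral)
  then have "\<forall>y\<in>C. \<exists>x\<in>K. dist x y < d / 4" by (auto simp: subset_iff)
  then obtain \<nu> where \<nu>: "\<And>y. y \<in> C \<Longrightarrow> \<nu> y \<in> K" "\<And>y. y \<in> C \<Longrightarrow> dist (\<nu> y) y < d / 4" by metis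
  \<comment> \<open>Rounding the argument and the value costs \<open>d / 4\<close> each, so two maps
    with the same code differ by at most \<open>d\<close>. Restricting to \<open>K\<close> puts all
    codes into a finite function space.\<close>
  define code where "code s = restrict (\<lambda>x. \<nu> (T s x)) K" for s
  have "range code \<subseteq> K \<rightarrow>\<^sub>E K" using \<nu>(1) T_in K(2) by (auto simp: code_def)
  then have "finite (range code)" using K(1) by (meson finite_PiE finite_subset)
  then obtain F where F: "finite F" "range code = code ` F" by (metis finite_subset_image subset_refl)
  show thesis
  proof (rule that[OF F(1)])
    fix s
    obtain s' where s': "s' \<in> F" "code s = code s'" using F(2) by (metis imageE rangeI)
    have "norm (T s x - T s' x) \<le> d" if x: "x \<in> C" for x
    proof -
      let ?a = "\<nu> x"
      have a: "?a \<in> K" "?a \<in> C" using \<nu>(1)[OF x] K(2) by auto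
      have near: "norm (T u x - \<nu> (T u ?a)) \<le> d / 2" for u
      proof -
        have "norm (T u x - T u ?a) \<le> d / 4"
          using T_nonexpansive[OF x a(2), of u] \<nu>(2)[OF x] by (simp add: dist_norm norm_minus_commute)
        moreover have "norm (T u ?a - \<nu> (T u ?a)) \<le> d / 4"
          using \<nu>(2)[OF T_in[OF a(2), of u]] by (simp add: dist_norm norm_minus_commute)
        ultimately show ?thesis using norm_triangle_le_diff norm_diff_triangle_le by fastforce
      qed
      have "\<nu> (T s ?a) = \<nu> (T s' ?a)" using fun_cong[OF s'(2), of ?a] a by (simp add: code_def)
      then have "norm (T s x - T s' x) \<le> d / 2 + d / 2"
        using near[of s] near[of s'] by (metis norm_diff_triangle_le norm_minus_commute)
      then show ?thesis by simp
    qed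
    then show "\<exists>s'\<in>F. \<forall>x\<in>C. norm (T s x - T s' x) \<le> d" using s'(1) by blast
  qed
qed

text \<open>Working in the product over \<open>F\<close> provides one combination for all
  \<open>s \<in> F\<close>. If none came within \<open>d\<close>, Hahn-Banach would give functionals
  \<open>j s\<close> whose total on the orbit exceeds its value at \<open>z\<close> by at least
  \<open>d\<close>; averaging with the means and passing to the limit contradicts
  \<open>lim\<close>.\<close>

lemma finite_convex_combination:
  assumes m: "\<And>n. mean_on X (m n)" and z: "z \<in> C"
    and lim: "\<And>s (j :: 'e \<Rightarrow>\<^sub>L real). (\<lambda>n. m n (\<lambda>t. blinfun_apply j (T (s * t) z))) \<longlonglongrightarrow> blinfun_apply j z"
    and F: "finite F" and d: "d > 0"
  shows "\<exists>J c. finite J \<and> (\<forall>t\<in>J. 0 \<le> c t) \<and> sum c J = 1 \<and>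
    (\<Sum>s\<in>F. norm ((\<Sum>t\<in>J. c t *\<^sub>R T s (T t z)) - z)) < d"
proof (rule ccontr)
  assume "\<not> ?thesis"
  then have ge: "d \<le> (\<Sum>s\<in>F. norm ((\<Sum>t\<in>J. c t *\<^sub>R T s (T t z)) - z))"
    if "finite J" "\<And>t. t \<in> J \<Longrightarrow> 0 \<le> c t" "sum c J = 1" for J c
    using that by (meson not_le)
  define sc where "sc = (\<lambda>(c::real) (h :: 's \<Rightarrow> 'e) s. c *\<^sub>R h s)"
  interpret V: real_vector_space sc
    by unfold_locales (auto simp: sc_def algebra_simps)
  define p where "p = (\<lambda>h :: 's \<Rightarrow> 'e. \<Sum>s\<in>F. norm (h s))"
  have p: "sublinear sc p"
    unfolding sublinear_def
  proof (intro conjI allI impI)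
    show "p (g + h) \<le> p g + p h" for g h
      unfolding p_def by (auto simp: norm_triangle_ineq simp flip: sum.distrib intro!: sum_mono)
    show "p (sc t h) \<le> t * p h" if "t > 0" for t h
      unfolding p_def sc_def using that by (simp add: sum_distrib_left)
  qed
  define v where "v = (\<lambda>t s. T s (T t z) - z)"
  \<comment> \<open>The cone generated by the pairs \<open>(v t, d)\<close>; it is dominated by
    \<open>p\<close> because normalised weights fall under \<open>ge\<close>.\<close>
  define G where "G = {((\<lambda>s. \<Sum>t\<in>J. c t *\<^sub>R v t s), d * sum c J) | J c. finite J \<and> (\<forall>t\<in>J. 0 \<le> c t)}"
  have GI: "((\<lambda>s. \<Sum>t\<in>J. c t *\<^sub>R v t s), d * sum c J) \<in> G"
    if "finite J" "\<forall>t\<in>J. 0 \<le> c t" for J c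
    unfolding G_def using that by blast
  have G: "dominated_cone sc p G"
    unfolding dominated_cone_def
  proof (intro conjI allI impI)
    show "(0, 0) \<in> G" using GI[of "{}"] by (simp add: zero_fun_def)
  next
    fix g r h s assume "(g, r) \<in> G" "(h, s) \<in> G"
    then obtain J c K b where J: "finite J" "\<forall>t\<in>J. 0 \<le> c t" and K: "finite K" "\<forall>t\<in>K. 0 \<le> b t"
      and gr: "g = (\<lambda>s. \<Sum>t\<in>J. c t *\<^sub>R v t s)" "r = d * sum c J"
      and hs: "h = (\<lambda>s. \<Sum>t\<in>K. b t *\<^sub>R v t s)" "s = d * sum b K"
      unfolding G_def by blast
    define e where "e t = (if t \<in> J then c t else 0) + (if t \<in> K then b t else 0)" for t
    have "g + h = (\<lambda>s. \<Sum>t\<in>J \<union> K. e t *\<^sub>R v t s)"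
      unfolding gr hs e_def plus_fun_def by (simp only: sum_scaleR_union_weights[OF J(1) K(1)])
    moreover have "r + s = d * sum e (J \<union> K)"
      using sum_scaleR_union_weights[OF J(1) K(1), of c b "\<lambda>_. 1 :: real"]
      by (simp add: gr hs e_def distrib_left)
    moreover have "finite (J \<union> K)" "\<forall>t\<in>J \<union> K. 0 \<le> e t" using J K by (auto simp: e_def)
    ultimately show "(g + h, r + s) \<in> G" using GI[of "J \<union> K" e] by simp
  next
    fix g r and a :: real assume a: "a > 0" and "(g, r) \<in> G"
    then obtain J c where J: "finite J" "\<forall>t\<in>J. 0 \<le> c t"
      and gr: "g = (\<lambda>s. \<Sum>t\<in>J. c t *\<^sub>R v t s)" "r = d * sum c J"
      unfolding G_def by blast
    have "sc a g = (\<lambda>s. \<Sum>t\<in>J. (a * c t) *\<^sub>R v t s)" "a * r = d * sum (\<lambda>t. a * c t) J"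
      by (simp_all add: gr sc_def scaleR_sum_right sum_distrib_left mult_ac)
    moreover have "\<forall>t\<in>J. 0 \<le> a * c t" using J a by simp
    ultimately show "(sc a g, a * r) \<in> G" using GI[OF J(1), of "\<lambda>t. a * c t"] by simp
  next
    fix g r assume "(g, r) \<in> G"
    then obtain J c where J: "finite J" "\<And>t. t \<in> J \<Longrightarrow> 0 \<le> c t"
      and gr: "g = (\<lambda>s. \<Sum>t\<in>J. c t *\<^sub>R v t s)" "r = d * sum c J"
      unfolding G_def by blast
    define L where "L = sum c J"
    have L0: "L \<ge> 0" unfolding L_def by (rule sum_nonneg) (rule J)
    show "r \<le> p g"
    proof (cases "L = 0")
      case True
      then show ?thesis by (simp add: gr flip: L_def) (simp add: p_def sum_nonneg)
    next
      case False
      then have L: "L > 0" using L0 by simp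
      define b where "b t = c t / L" for t
      have b1: "sum b J = 1" using L by (simp add: b_def L_def flip: sum_divide_distrib)
      have "(\<Sum>t\<in>J. b t *\<^sub>R T s (T t z)) - z = (1 / L) *\<^sub>R g s" for s
      proof -
        have "(1 / L) *\<^sub>R g s = (\<Sum>t\<in>J. b t *\<^sub>R v t s)"
          by (simp add: gr b_def scaleR_sum_right)
        also have "\<dots> = (\<Sum>t\<in>J. b t *\<^sub>R T s (T t z)) - sum b J *\<^sub>R z"
          by (simp add: v_def scaleR_diff_right sum_subtractf scaleR_sum_left)
        finally show ?thesis using b1 by simp
      qed
      then have "d \<le> (\<Sum>s\<in>F. norm ((1 / L) *\<^sub>R g s))"
        using ge[OF J(1) _ b1] J(2) L0 by (simp add: b_def)
      also have "\<dots> = p g / L" using L by (simp add: p_def sum_divide_distrib)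
      finally show ?thesis using L by (simp add: gr flip: L_def) (simp add: field_simps)
    qed
  qed
  obtain f where f: "\<And>g h. f (g + h) = f g + f h" "\<And>t h. f (sc t h) = t * f h"
    "\<And>h. f h \<le> p h" "\<And>g r. (g, r) \<in> G \<Longrightarrow> r \<le> f g"
    using V.Hahn_Banach_cone[OF p G] by blast
  obtain j :: "'s \<Rightarrow> 'e \<Rightarrow>\<^sub>L real" where j: "\<And>h. f h = (\<Sum>s\<in>F. blinfun_apply (j s) (h s))"
    by (rule product_functional_decomposition[OF F, of f]) (use f in \<open>auto simp: sc_def p_def\<close>)
  define H where "H = (\<lambda>t. \<Sum>s\<in>F. blinfun_apply (j s) (T (s * t) z))"
  have term_X: "(\<lambda>t. blinfun_apply k (T (s * t) z)) \<in> X" for s k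
    using invariant orbit[OF z, of k] by (auto simp: left_invariant_def left_translate_def)
  have H_X: "H \<in> X" unfolding H_def by (rule subspace_B_sum[OF subspace F term_X])
  have "d + (\<Sum>s\<in>F. blinfun_apply (j s) z) \<le> H t" for t
  proof -
    have "(v t, d) \<in> G" using GI[of "{t}" "\<lambda>_. 1"] by simp
    then have "d \<le> f (v t)" by (rule f(4))
    also have "\<dots> = H t - (\<Sum>s\<in>F. blinfun_apply (j s) z)"
      by (simp add: j v_def H_def T_mult[OF z] blinfun.diff_right sum_subtractf)
    finally show ?thesis by simp
  qed
  then have "d + (\<Sum>s\<in>F. blinfun_apply (j s) z) \<le> m n H" for n
    by (rule mean_ge[OF subspace one m H_X])
  moreover have "(\<lambda>n. m n H) \<longlonglongrightarrow> (\<Sum>s\<in>F. blinfun_apply (j s) z)"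
    unfolding H_def mean_sum[OF subspace m F term_X] by (intro tendsto_sum lim)
  ultimately have "d + (\<Sum>s\<in>F. blinfun_apply (j s) z) \<le> (\<Sum>s\<in>F. blinfun_apply (j s) z)"
    by (intro LIMSEQ_le_const) auto
  then show False using d by simp
qed

text \<open>A combination good for a finite uniform net of maps is good for all \<open>s\<close>,
  since every \<open>T s\<close> is uniformly close to a map of the net; each of the two errors is
  at most \<open>d / 2\<close>.\<close>

lemma uniform_convex_combination:
  assumes m: "\<And>n. mean_on X (m n)" and z: "z \<in> C"
    and lim: "\<And>s (j :: 'e \<Rightarrow>\<^sub>L real). (\<lambda>n. m n (\<lambda>t. blinfun_apply j (T (s * t) z))) \<longlonglongrightarrow> blinfun_apply j z"
    and d: "d > 0"
  obtains J c where "finite J" "\<And>t. t \<in> J \<Longrightarrow> 0 \<le> c t" "sum c J = 1"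
    "\<And>s. norm ((\<Sum>t\<in>J. c t *\<^sub>R T s (T t z)) - z) \<le> d"
proof -
  have d2: "d / 2 > 0" using d by simp
  obtain F where F: "finite F" "\<And>s. \<exists>s'\<in>F. \<forall>x\<in>C. norm (T s x - T s' x) \<le> d / 2"
    using finite_uniform_net[OF d2] by metis
  obtain J c where J: "finite J" "\<And>t. t \<in> J \<Longrightarrow> 0 \<le> c t" "sum c J = 1"
    and small: "(\<Sum>s\<in>F. norm ((\<Sum>t\<in>J. c t *\<^sub>R T s (T t z)) - z)) < d / 2"
    using finite_convex_combination[OF m z lim F(1) d2] by blast
  show thesis
  proof (rule that[OF J])
    fix s
    obtain s' where s': "s' \<in> F" "\<And>x. x \<in> C \<Longrightarrow> norm (T s x - T s' x) \<le> d / 2" using F(2) by blast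
    have "norm ((\<Sum>t\<in>J. c t *\<^sub>R T s' (T t z)) - z) \<le> (\<Sum>s\<in>F. norm ((\<Sum>t\<in>J. c t *\<^sub>R T s (T t z)) - z))"
      by (rule member_le_sum[OF s'(1) _ F(1)]) simp
    then have 1: "norm ((\<Sum>t\<in>J. c t *\<^sub>R T s' (T t z)) - z) \<le> d / 2" using small by simp
    have "norm ((\<Sum>t\<in>J. c t *\<^sub>R T s (T t z)) - (\<Sum>t\<in>J. c t *\<^sub>R T s' (T t z)))
        = norm (\<Sum>t\<in>J. c t *\<^sub>R (T s (T t z) - T s' (T t z)))"
      by (simp add: scaleR_diff_right sum_subtractf)
    also have "\<dots> \<le> (\<Sum>t\<in>J. c t * (d / 2))"
    proof (rule sum_norm_le)
      fix t assume "t \<in> J"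
      then have "0 \<le> c t" by (rule J(2))
      with mult_left_mono[OF s'(2)[OF T_in[OF z, of t]] this]
      show "norm (c t *\<^sub>R (T s (T t z) - T s' (T t z))) \<le> c t * (d / 2)" by simp
    qed
    also have "\<dots> = d / 2" using J(3) by (simp flip: sum_distrib_right sum_divide_distrib)
    finally show "norm ((\<Sum>t\<in>J. c t *\<^sub>R T s (T t z)) - z) \<le> d"
      using 1 norm_diff_triangle_le by fastforce
  qed
qed

text \<open>Among all limits of the translated configurations \<open>t \<mapsto> T s (y t)\<close>, one with the least sum
  of mutual distances is mapped isometrically by every \<open>T u\<close>.\<close>

lemma isometric_limit_configuration:
  fixes y :: "'j \<Rightarrow> 'e"
  assumes J: "finite J" and y: "\<And>t. t \<in> J \<Longrightarrow> y t \<in> C"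
  obtains w \<sigma> where "\<And>t. t \<in> J \<Longrightarrow> w t \<in> C" "\<And>t. t \<in> J \<Longrightarrow> (\<lambda>n. T (\<sigma> n) (y t)) \<longlonglongrightarrow> w t"
    "\<And>u t t'. t \<in> J \<Longrightarrow> t' \<in> J \<Longrightarrow> norm (T u (w t) - T u (w t')) = norm (w t - w t')"
proof -
  define \<Phi> where "\<Phi> a = (\<Sum>(t, t')\<in>J \<times> J. norm (a t - a t'))" for a :: "'j \<Rightarrow> 'e"
  define \<phi> where "\<phi> s = \<Phi> (\<lambda>t. T s (y t))" for s
  define l where "l = (INF s. \<phi> s)"
  have "\<phi> s \<ge> 0" for s unfolding \<phi>_def \<Phi>_def by (intro sum_nonneg) auto
  then have bdd: "bdd_below (range \<phi>)" by (intro bdd_belowI[of _ 0]) auto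
  then have lower: "l \<le> \<phi> s" for s unfolding l_def by (intro cINF_lower) auto
  \<comment> \<open>The infimum of \<phi> need not be attained on the semigroup, so a minimising
    sequence is used and its limit configuration attains it.\<close>
  have "\<exists>s. \<phi> s < l + 1 / real (Suc n)" for n
    using cINF_less_iff[OF _ bdd, of "l + 1 / real (Suc n)"] by (auto simp: l_def)
  then obtain \<tau> where \<tau>: "\<And>n. \<phi> (\<tau> n) < l + 1 / real (Suc n)" by metis
  have "(\<lambda>n. \<phi> (\<tau> n)) \<longlonglongrightarrow> l"
  proof (rule tendsto_sandwich[of "\<lambda>_. l" _ _ "\<lambda>n. l + 1 / real (Suc n)"])
    show "(\<lambda>n. l + 1 / real (Suc n)) \<longlonglongrightarrow> l"
      using tendsto_add[OF tendsto_const LIMSEQ_inverse_real_of_nat, of l] by (simp add: inverse_eq_divide)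
  qed (use lower less_imp_le[OF \<tau>] in auto)
  then have lim: "(\<lambda>n. \<phi> (\<tau> (r n))) \<longlonglongrightarrow> l" if "strict_mono r" for r
    using LIMSEQ_subseq_LIMSEQ[OF _ that] by (auto simp: o_def)
  obtain r w where r: "strict_mono r"
    and w: "\<And>t. t \<in> J \<Longrightarrow> w t \<in> C" "\<And>t. t \<in> J \<Longrightarrow> (\<lambda>n. T (\<tau> (r n)) (y t)) \<longlonglongrightarrow> w t"
    using finite_family_common_subsequence[OF compact J, of "\<lambda>n t. T (\<tau> n) (y t)"] T_in y by blast
  have \<Phi>_lim: "(\<lambda>n. \<Phi> (a n)) \<longlonglongrightarrow> \<Phi> b" if "\<And>t. t \<in> J \<Longrightarrow> (\<lambda>n. a n t) \<longlonglongrightarrow> b t" for a b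
    unfolding \<Phi>_def using that by (auto intro!: tendsto_sum tendsto_norm tendsto_diff simp: case_prod_unfold)
  have "\<Phi> w = l"
    using \<Phi>_lim[of "\<lambda>n t. T (\<tau> (r n)) (y t)" w] w(2) lim[OF r] unfolding \<phi>_def
    by (blast intro: LIMSEQ_unique)
  have iso: "norm (T u (w t) - T u (w t')) = norm (w t - w t')" if t: "t \<in> J" "t' \<in> J" for u t t'
  proof -
    have "(\<lambda>n. T u (T (\<tau> (r n)) (y t))) \<longlonglongrightarrow> T u (w t)" if "t \<in> J" for t
      using that w(2) y T_in by (intro T_tendsto(2)) auto
    then have "(\<lambda>n. \<Phi> (\<lambda>t. T u (T (\<tau> (r n)) (y t)))) \<longlonglongrightarrow> \<Phi> (\<lambda>t. T u (w t))" by (rule \<Phi>_lim)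
    \<comment> \<open>Applying \<open>T u\<close> to a translate gives another translate, so the
      limit configuration after \<open>T u\<close> still has total distance at least
      \<open>l\<close>. Nonexpansiveness bounds each distance from above, hence none of them
      shrinks.\<close>
    moreover have "\<Phi> (\<lambda>t. T u (T (\<tau> (r n)) (y t))) = \<phi> (u * \<tau> (r n))" for n
      unfolding \<phi>_def \<Phi>_def using y by (intro sum.cong) (auto simp: T_mult)
    ultimately have "(\<lambda>n. \<phi> (u * \<tau> (r n))) \<longlonglongrightarrow> \<Phi> (\<lambda>t. T u (w t))" by simp
    then have "l \<le> \<Phi> (\<lambda>t. T u (w t))" by (rule LIMSEQ_le_const) (use lower in auto)
    moreover have le: "norm (T u (w t) - T u (w t')) \<le> norm (w t - w t')" if "t \<in> J" "t' \<in> J" for t t'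
      using that w(1) by (intro T_nonexpansive) auto
    then have "\<Phi> (\<lambda>t. T u (w t)) \<le> \<Phi> w" unfolding \<Phi>_def by (intro sum_mono) auto
    ultimately have "(\<Sum>x\<in>J \<times> J. norm (w (fst x) - w (snd x)) - norm (T u (w (fst x)) - T u (w (snd x)))) = 0"
      using \<open>\<Phi> w = l\<close> by (simp add: \<Phi>_def sum_subtractf case_prod_unfold)
    then have "\<forall>x\<in>J \<times> J. norm (w (fst x) - w (snd x)) - norm (T u (w (fst x)) - T u (w (snd x))) = 0"
      using J le by (subst (asm) sum_nonneg_eq_0_iff) auto
    then show ?thesis using t by auto
  qed
  show thesis by (rule that[OF w iso])
qed

lemma limit_in_Fix_rep:
  assumes strict: "strictly_convex_space TYPE('e)"
    and m: "\<And>n. mean_on X (m n)" and z: "z \<in> C"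
    and lim: "\<And>s (j :: 'e \<Rightarrow>\<^sub>L real). (\<lambda>n. m n (\<lambda>t. blinfun_apply j (T (s * t) z))) \<longlonglongrightarrow> blinfun_apply j z"
  shows "z \<in> Fix_rep C T"
proof -
  have "norm (T u z - z) \<le> 0 + d" if d: "d > 0" for u d
  proof -
    have d2: "d / 2 > 0" using d by simp
    obtain J c where J: "finite J" "\<And>t. t \<in> J \<Longrightarrow> 0 \<le> c t" "sum c J = 1"
      and near: "\<And>s. norm ((\<Sum>t\<in>J. c t *\<^sub>R T s (T t z)) - z) \<le> d / 2"
      using uniform_convex_combination[OF m z lim d2] by metis
    obtain w \<sigma> where w: "\<And>t. t \<in> J \<Longrightarrow> w t \<in> C"
      "\<And>t. t \<in> J \<Longrightarrow> (\<lambda>n. T (\<sigma> n) (T t z)) \<longlonglongrightarrow> w t"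
      and iso: "\<And>u t t'. t \<in> J \<Longrightarrow> t' \<in> J \<Longrightarrow> norm (T u (w t) - T u (w t')) = norm (w t - w t')"
      using isometric_limit_configuration[OF J(1), of "\<lambda>t. T t z"] T_in[OF z] by metis
    define b where "b = (\<Sum>t\<in>J. c t *\<^sub>R w t)"
    have bC: "b \<in> C" unfolding b_def by (rule convex_sum[OF J(1) convex J(3,2) w(1)])
    have Tb: "T u b = (\<Sum>t\<in>J. c t *\<^sub>R T u (w t))" unfolding b_def
      by (rule nonexpansive_affine[where w = w and c = c, OF strict convex _ J(1) w(1) iso J(2,3)])
        (use T_nonexpansive in \<open>auto simp: nonexpansive_on_def\<close>)
    \<comment> \<open>The bound \<open>near\<close> is uniform in \<open>s\<close>, so it survives
      the limit along \<open>\<sigma> n\<close> here and along \<open>u * \<sigma> n\<close> below;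
      thus both \<open>b\<close> and \<open>T u b\<close> are close to \<open>z\<close>.\<close>
    have "(\<lambda>n. norm ((\<Sum>t\<in>J. c t *\<^sub>R T (\<sigma> n) (T t z)) - z)) \<longlonglongrightarrow> norm (b - z)"
      unfolding b_def by (intro tendsto_intros w(2))
    then have 1: "norm (b - z) \<le> d / 2" by (rule LIMSEQ_le_const2) (use near in auto)
    have "(\<lambda>n. T u (T (\<sigma> n) (T t z))) \<longlonglongrightarrow> T u (w t)" if "t \<in> J" for t
      using w(2)[OF that] by (intro T_tendsto(2) T_in z)
    then have "(\<lambda>n. norm ((\<Sum>t\<in>J. c t *\<^sub>R T u (T (\<sigma> n) (T t z))) - z)) \<longlonglongrightarrow> norm (T u b - z)"
      unfolding Tb by (intro tendsto_intros)
    moreover have "norm ((\<Sum>t\<in>J. c t *\<^sub>R T u (T (\<sigma> n) (T t z))) - z) \<le> d / 2" for n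
      using near[of "u * \<sigma> n"] by (simp add: T_mult[OF T_in[OF z]])
    ultimately have 2: "norm (T u b - z) \<le> d / 2" by (intro LIMSEQ_le_const2) auto
    have "norm (T u z - T u b) \<le> d / 2"
      using T_nonexpansive[OF z bC, of u] 1 by (simp add: norm_minus_commute)
    then show ?thesis using 2 norm_diff_triangle_le by fastforce
  qed
  then have "norm (T u z - z) \<le> 0" for u by (rule field_le_epsilon)
  then show ?thesis using z by (simp add: Fix_rep_def)
qed

end

section \<open>Sunny retractions and implicit iterations\<close>

text \<open>In a smooth space the support functional \<open>j\<close> of \<open>w\<close> is the derivative of the norm at \<open>w\<close>,
  which is nonnegative in every direction along which the norm does not decrease.\<close>

lemma smooth_support_nonneg:
  fixes w a :: "'e::real_normed_vector"
  assumes smooth: "smooth_space TYPE('e)" and w: "w \<noteq> 0"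
    and j: "norm j \<le> 1" "blinfun_apply j w = norm w"
    and incr: "\<And>t. 0 \<le> t \<Longrightarrow> norm w \<le> norm (w + t *\<^sub>R a)"
  shows "0 \<le> blinfun_apply j a"
proof (cases "a = 0")
  case True
  then show ?thesis by (simp add: blinfun.zero_right)
next
  case False
  \<comment> \<open>Smoothness is formulated for unit vectors, so \<open>w\<close> and
    \<open>a\<close> are normalised first.\<close>
  define x where "x = (1 / norm w) *\<^sub>R w"
  define y where "y = (1 / norm a) *\<^sub>R a"
  have nx: "norm x = 1" and ny: "norm y = 1" using w False by (simp_all add: x_def y_def)
  obtain l where l: "((\<lambda>t::real. (norm (x + t *\<^sub>R y) - norm x) / t) \<longlongrightarrow> l) (at 0)"
    using smooth nx ny unfolding smooth_space_def by blast
  have jx: "blinfun_apply j x = 1" using j w by (simp add: x_def blinfun.scaleR_right)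
  have "norm (x + t *\<^sub>R y) \<ge> 1 + t * blinfun_apply j y" for t
  proof -
    have "blinfun_apply j (x + t *\<^sub>R y) \<le> norm j * norm (x + t *\<^sub>R y)"
      using norm_blinfun[of j "x + t *\<^sub>R y"] by simp
    also have "\<dots> \<le> 1 * norm (x + t *\<^sub>R y)" by (rule mult_right_mono[OF j(1)]) simp
    finally show ?thesis by (simp add: blinfun.add_right blinfun.scaleR_right jx)
  qed
  \<comment> \<open>Quotients from the left lie below \<open>blinfun_apply j y\<close> since
    \<open>j\<close> supports the norm at \<open>x\<close>; those from the right are nonnegative by
    \<open>incr\<close>. Smoothness gives both sides the same limit \<open>l\<close>.\<close>
  then have "(norm (x + t *\<^sub>R y) - norm x) / t \<le> blinfun_apply j y" if "t < 0" for t
    using that by (simp add: nx neg_divide_le_eq mult.commute le_diff_eq add.commute)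
  then have "eventually (\<lambda>t. (norm (x + t *\<^sub>R y) - norm x) / t \<le> blinfun_apply j y) (at_left 0)"
    by (auto simp: eventually_at_filter)
  then have "l \<le> blinfun_apply j y"
    using l by (intro tendsto_upperbound[of _ l "at_left 0"]) (auto simp: filterlim_at_split)
  moreover have "0 \<le> (norm (x + t *\<^sub>R y) - norm x) / t" if t: "0 < t" for t
  proof -
    have "x + t *\<^sub>R y = (1 / norm w) *\<^sub>R (w + (t * norm w / norm a) *\<^sub>R a)"
      using w by (simp add: x_def y_def scaleR_add_right)
    moreover have "norm w \<le> norm (w + (t * norm w / norm a) *\<^sub>R a)" by (rule incr) (use t in simp)
    ultimately have "1 \<le> norm (x + t *\<^sub>R y)" using w by (simp add: le_divide_eq)
    then show ?thesis using t nx by simp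
  qed
  then have "eventually (\<lambda>t. 0 \<le> (norm (x + t *\<^sub>R y) - norm x) / t) (at_right 0)"
    by (auto simp: eventually_at_filter)
  then have "0 \<le> l"
    using l by (intro tendsto_lowerbound[of _ l "at_right 0"]) (auto simp: filterlim_at_split)
  ultimately have "0 \<le> blinfun_apply j y" by simp
  then show ?thesis using False by (simp add: y_def blinfun.scaleR_right zero_le_divide_iff)
qed

text \<open>With the normalised duality map \<open>J\<close> the second condition reads
  \<open>\<langle>u - q, J (p - q)\<rangle> \<le> 0\<close> for all \<open>p \<in> D\<close>.\<close>

definition sunny_point :: "'e::real_normed_vector set \<Rightarrow> 'e \<Rightarrow> 'e \<Rightarrow> bool" where
  "sunny_point D u q \<longleftrightarrow> q \<in> D \<and> (\<forall>p\<in>D. \<forall>t\<ge>0. norm (q - p) \<le> norm (q - p + t *\<^sub>R (u - q)))"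

text \<open>A norming functional \<open>j\<close> of \<open>q - q'\<close> is nonnegative at
  \<open>u - q\<close> and at \<open>q' - v\<close>; adding the two gives
  \<open>norm (q - q') \<le> blinfun_apply j (u - v)\<close>.\<close>

lemma sunny_point_nonexpansive:
  fixes D :: "'e::real_normed_vector set"
  assumes smooth: "smooth_space TYPE('e)" and q: "sunny_point D u q" and q': "sunny_point D v q'"
  shows "norm (q - q') \<le> norm (u - v)"
proof (cases "q - q' = 0")
  case True
  then show ?thesis by simp
next
  case False
  define w where "w = q - q'"
  obtain j :: "'e \<Rightarrow>\<^sub>L real" where j: "norm j \<le> 1" "blinfun_apply j w = norm w"
    by (rule norming_functional)
  have w: "w \<noteq> 0" using False by (simp add: w_def)
  have 1: "0 \<le> blinfun_apply j (u - q)"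
    by (rule smooth_support_nonneg[OF smooth w j]) (use q q' in \<open>auto simp: w_def sunny_point_def\<close>)
  have 2: "0 \<le> blinfun_apply j (q' - v)"
  proof (rule smooth_support_nonneg[OF smooth w j])
    fix t :: real assume "0 \<le> t"
    then have "norm (q' - q) \<le> norm (q' - q + t *\<^sub>R (v - q'))" using q q' by (auto simp: sunny_point_def)
    moreover have "q' - q + t *\<^sub>R (v - q') = - (w + t *\<^sub>R (q' - v))" by (simp add: w_def algebra_simps)
    then have "norm (q' - q + t *\<^sub>R (v - q')) = norm (w + t *\<^sub>R (q' - v))" by (metis norm_minus_cancel)
    ultimately show "norm w \<le> norm (w + t *\<^sub>R (q' - v))" by (simp add: w_def norm_minus_commute)
  qed
  have "norm w \<le> blinfun_apply j (u - v)"
    using 1 2 j(2) by (simp add: w_def blinfun.diff_right)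
  also have "\<dots> \<le> norm j * norm (u - v)" using norm_blinfun[of j "u - v"] by simp
  also have "\<dots> \<le> 1 * norm (u - v)" by (rule mult_right_mono[OF j(1)]) simp
  finally show ?thesis by (simp add: w_def)
qed

lemma sunny_point_self: "u \<in> D \<Longrightarrow> sunny_point D u u"
  by (simp add: sunny_point_def)

lemma sunny_point_unique:
  fixes D :: "'e::real_normed_vector set"
  assumes "smooth_space TYPE('e)" "sunny_point D u q" "sunny_point D u q'"
  shows "q = q'"
  using sunny_point_nonexpansive[OF assms] by simp

text \<open>The vector \<open>w\<close> is a convex combination of \<open>w - c *\<^sub>R v\<close>
  and \<open>w + t *\<^sub>R v\<close>, so by convexity of the norm these cannot bring one end below
  \<open>norm w\<close> unless the other rises above it.\<close>

lemma norm_le_ray: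
  fixes w v :: "'e::real_normed_vector"
  assumes c: "c > 0" and le: "norm (w - c *\<^sub>R v) \<le> norm w" and t: "t \<ge> 0"
  shows "norm w \<le> norm (w + t *\<^sub>R v)"
proof -
  have "(t + c) *\<^sub>R w = t *\<^sub>R (w - c *\<^sub>R v) + c *\<^sub>R (w + t *\<^sub>R v)" by (simp add: algebra_simps)
  then have "(t + c) * norm w = norm (t *\<^sub>R (w - c *\<^sub>R v) + c *\<^sub>R (w + t *\<^sub>R v))"
    using c t by (metis abs_of_nonneg add_nonneg_nonneg less_imp_le norm_scaleR)
  also have "\<dots> \<le> t * norm (w - c *\<^sub>R v) + c * norm (w + t *\<^sub>R v)"
    using norm_triangle_ineq[of "t *\<^sub>R (w - c *\<^sub>R v)" "c *\<^sub>R (w + t *\<^sub>R v)"] c t by simp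
  also have "\<dots> \<le> t * norm w + c * norm (w + t *\<^sub>R v)" using mult_left_mono[OF le t] by simp
  finally have "c * norm w \<le> c * norm (w + t *\<^sub>R v)" by (simp add: algebra_simps)
  then show ?thesis using c by simp
qed

text \<open>For \<open>t \<le> 1\<close> the ray stays in \<open>C\<close>, where sunniness and
  nonexpansiveness apply. Beyond \<open>u\<close> it may leave \<open>C\<close>, and convexity of
  the norm continues the inequality. This yields uniqueness of the retraction.\<close>

lemma sunny_nonexpansive_retraction_sunny_point:
  fixes C :: "'e::real_normed_vector set"
  assumes C: "convex C" and Q: "sunny_nonexpansive_retraction C D Q" and u: "u \<in> C"
  shows "sunny_point D u (Q u)"
  unfolding sunny_point_def
proof (intro conjI ballI allI impI)
  have DC: "D \<subseteq> C" and im: "Q ` C = D" and fixed: "\<And>p. p \<in> D \<Longrightarrow> Q p = p"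
    and sunny: "\<And>t. t \<ge> 0 \<Longrightarrow> Q u + t *\<^sub>R (u - Q u) \<in> C \<Longrightarrow> Q (Q u + t *\<^sub>R (u - Q u)) = Q u"
    and ne: "\<And>x y. x \<in> C \<Longrightarrow> y \<in> C \<Longrightarrow> norm (Q x - Q y) \<le> norm (x - y)"
    using Q u unfolding sunny_nonexpansive_retraction_def retraction_onto_def sunny_on_def nonexpansive_on_def
    by auto
  show Qu: "Q u \<in> D" using im u by blast
  fix p and t :: real assume p: "p \<in> D" and t: "t \<ge> 0"
  define w where "w = Q u - p"
  define v where "v = u - Q u"
  have short: "norm w \<le> norm (w + s *\<^sub>R v)" if s: "0 \<le> s" "s \<le> 1" for s
  proof -
    have "(1 - s) *\<^sub>R Q u + s *\<^sub>R u \<in> C" using s u Qu DC by (intro convexD[OF C]) auto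
    also have "(1 - s) *\<^sub>R Q u + s *\<^sub>R u = Q u + s *\<^sub>R (u - Q u)" by (simp add: algebra_simps)
    finally have x: "Q u + s *\<^sub>R (u - Q u) \<in> C" .
    have "norm (Q u - p) \<le> norm (Q u + s *\<^sub>R (u - Q u) - p)"
      using ne[OF x, of p] sunny[OF s(1) x] fixed[OF p] p DC by auto
    then show ?thesis by (simp add: w_def v_def algebra_simps)
  qed
  have "norm w \<le> norm (w + t *\<^sub>R v)"
  proof (cases "t \<le> 1")
    case True
    then show ?thesis using short t by blast
  next
    case False
    have "norm (w + v) \<le> norm (w + v + (t - 1) *\<^sub>R v)"
      by (rule norm_le_ray[of 1]) (use short[of 1] False in auto)
    moreover have "w + v + (t - 1) *\<^sub>R v = w + t *\<^sub>R v" by (simp add: algebra_simps)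
    ultimately show ?thesis using short[of 1] by simp
  qed
  then show "norm (Q u - p) \<le> norm (Q u - p + t *\<^sub>R (u - Q u))" by (simp add: w_def v_def)
qed

text \<open>Everything follows from uniqueness and nonexpansiveness of sunny points. Sunniness holds
  because \<open>P u\<close> is also a sunny point for every point on the ray from
  \<open>P u\<close> through \<open>u\<close>.\<close>

lemma sunny_point_retraction:
  fixes C :: "'e::real_normed_vector set"
  assumes smooth: "smooth_space TYPE('e)" and D: "D \<subseteq> C" and P: "\<And>u. u \<in> C \<Longrightarrow> sunny_point D u (P u)"
  shows "sunny_nonexpansive_retraction C D P"
  unfolding sunny_nonexpansive_retraction_def retraction_onto_def
proof (intro conjI ballI)
  show fixed: "P u = u" if "u \<in> D" for u
    using sunny_point_unique[OF smooth P sunny_point_self] that D by blast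
  show "P ` C = D" using P fixed D by (force simp: sunny_point_def)
  show "nonexpansive_on C P"
    unfolding nonexpansive_on_def using sunny_point_nonexpansive[OF smooth P P] by blast
  show "sunny_on C P"
    unfolding sunny_on_def
  proof (intro ballI allI impI, elim conjE)
    fix u and t :: real
    let ?w = "P u + t *\<^sub>R (u - P u)"
    assume u: "u \<in> C" and t: "t \<ge> 0" and w: "?w \<in> C"
    have "sunny_point D ?w (P u)"
      using P[OF u] t unfolding sunny_point_def by (simp add: zero_le_mult_iff)
    then show "P ?w = P u" using sunny_point_unique[OF smooth P[OF w]] by blast
  qed
qed (rule D)

lemma compact_cluster_point_tendsto:
  fixes z :: "nat \<Rightarrow> 'e::metric_space"
  assumes C: "compact C" and z: "\<And>n. z n \<in> C"
    and cluster: "\<And>r l. strict_mono r \<Longrightarrow> (\<lambda>n. z (r n)) \<longlonglongrightarrow> l \<Longrightarrow> l = q"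
  shows "z \<longlonglongrightarrow> q"
proof (rule ccontr)
  assume "\<not> z \<longlonglongrightarrow> q"
  then obtain e where e: "e > 0" "\<And>N. \<exists>n\<ge>N. e \<le> dist (z n) q"
    unfolding lim_sequentially by (meson not_le)
  then have "infinite {n. e \<le> dist (z n) q}" by (simp add: infinite_nat_iff_unbounded_le)
  then obtain r :: "nat \<Rightarrow> nat" where r: "strict_mono r" "\<And>n. e \<le> dist (z (r n)) q"
    using infinite_enumerate[of "{n. e \<le> dist (z n) q}"] by auto
  obtain l s where s: "strict_mono s" and l: "((\<lambda>n. z (r n)) \<circ> s) \<longlonglongrightarrow> l"
    using C[unfolded compact_def, rule_format, of "\<lambda>n. z (r n)"] z by blast
  have lim: "(\<lambda>n. z (r (s n))) \<longlonglongrightarrow> l" using l by (simp add: o_def)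
  have "strict_mono (\<lambda>n. r (s n))" using strict_mono_o[OF r(1) s] by (simp add: o_def)
  from cluster[OF this lim] have "(\<lambda>n. dist (z (r (s n))) q) \<longlonglongrightarrow> 0"
    using iffD1[OF tendsto_dist_iff lim] by simp
  then have "e \<le> 0" by (rule LIMSEQ_le_const) (use r(2) in auto)
  then show False using e(1) by simp
qed

section \<open>Existence, cluster points and convergence of implicit iterations\<close>

locale viscosity = compact_action C T X
  for C :: "'e::banach set" and T :: "'s::semigroup_mult \<Rightarrow> 'e \<Rightarrow> 'e" and X :: "('s \<Rightarrow> real) set" +
  fixes \<mu> :: "nat \<Rightarrow> ('s \<Rightarrow> real) \<Rightarrow> real" and \<epsilon> :: "nat \<Rightarrow> real"
  assumes strict: "strictly_convex_space TYPE('e)"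
    and smooth: "smooth_space TYPE('e)"
    and regular: "left_regular X \<mu>"
    and \<epsilon>: "\<And>n. 0 < \<epsilon> n \<and> \<epsilon> n < 1"
    and \<epsilon>_lim: "\<epsilon> \<longlonglongrightarrow> 0"
begin

definition implicit_iteration :: "('e \<Rightarrow> 'e) \<Rightarrow> (nat \<Rightarrow> 'e) \<Rightarrow> bool" where
  "implicit_iteration f z \<longleftrightarrow>
     (\<forall>n. z n \<in> C \<and> z n = \<epsilon> n *\<^sub>R f (z n) + (1 - \<epsilon> n) *\<^sub>R T_mean (\<mu> n) T (z n))"

lemma mean: "mean_on X (\<mu> n)"
  using regular by (simp add: left_regular_def)

text \<open>For each \<open>n\<close> the right-hand side is a contraction of \<open>C\<close>: the
  share \<open>\<epsilon> n\<close> of \<open>f\<close> contracts strictly and the mean operator is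
  nonexpansive.\<close>

lemma implicit_iteration_exists:
  assumes f: "f ` C \<subseteq> C" and \<alpha>: "0 \<le> \<alpha>" "\<alpha> < 1"
    and contr: "\<And>x y. x \<in> C \<Longrightarrow> y \<in> C \<Longrightarrow> norm (f x - f y) \<le> \<alpha> * norm (x - y)"
  shows "\<exists>z. implicit_iteration f z"
proof -
  have "\<exists>x. x \<in> C \<and> \<epsilon> n *\<^sub>R f x + (1 - \<epsilon> n) *\<^sub>R T_mean (\<mu> n) T x = x" for n
  proof -
    define A where "A = T_mean (\<mu> n) T"
    define e where "e = \<epsilon> n"
    have e: "0 < e" "e < 1" using \<epsilon>[of n] by (simp_all add: e_def)
    let ?g = "\<lambda>x. e *\<^sub>R f x + (1 - e) *\<^sub>R A x"
    have AC: "A x \<in> C" if "x \<in> C" for x unfolding A_def by (rule T_mean_in[OF mean that])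
    have "\<exists>!x\<in>C. ?g x = x"
    proof (rule Banach_fix[where c = "e * \<alpha> + (1 - e)"])
      show "complete C" by (rule compact_imp_complete[OF compact])
      show "C \<noteq> {}" by (rule nonempty)
      show "0 \<le> e * \<alpha> + (1 - e)" using e \<alpha> by simp
      show "e * \<alpha> + (1 - e) < 1" using e \<alpha> mult_strict_left_mono[OF \<alpha>(2) e(1)] by simp
      show "?g ` C \<subseteq> C" using f AC e by (auto intro!: convexD[OF convex])
      fix x y assume xy: "x \<in> C" "y \<in> C"
      have "?g x - ?g y = e *\<^sub>R (f x - f y) + (1 - e) *\<^sub>R (A x - A y)" by (simp add: algebra_simps)
      then have "norm (?g x - ?g y) \<le> e * norm (f x - f y) + (1 - e) * norm (A x - A y)"
        using norm_triangle_ineq[of "e *\<^sub>R (f x - f y)" "(1 - e) *\<^sub>R (A x - A y)"] e by simp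
      also have "\<dots> \<le> e * (\<alpha> * norm (x - y)) + (1 - e) * norm (x - y)"
        using e contr[OF xy] T_mean_nonexpansive[OF mean xy, of n]
        by (intro add_mono mult_left_mono) (auto simp: A_def)
      finally show "dist (?g x) (?g y) \<le> (e * \<alpha> + (1 - e)) * dist x y"
        by (simp add: dist_norm algebra_simps)
    qed
    then show ?thesis by (auto simp: A_def e_def)
  qed
  then obtain z where "\<And>n. z n \<in> C \<and> \<epsilon> n *\<^sub>R f (z n) + (1 - \<epsilon> n) *\<^sub>R T_mean (\<mu> n) T (z n) = z n"
    by metis
  then show ?thesis unfolding implicit_iteration_def by (intro exI[of _ z]) simp
qed

text \<open>Left regularity carries the limit of the averaged orbit over to the averages translated
  by \<open>s\<close>.\<close>

lemma approximate_fixed_point_in_Fix_rep: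
  assumes z: "z \<in> C" and r: "strict_mono r" and lim: "(\<lambda>n. T_mean (\<mu> (r n)) T z) \<longlonglongrightarrow> z"
  shows "z \<in> Fix_rep C T"
proof (rule limit_in_Fix_rep[OF strict _ z])
  show "mean_on X (\<mu> (r n))" for n by (rule mean)
  fix s and j :: "'e \<Rightarrow>\<^sub>L real"
  let ?h = "\<lambda>t. blinfun_apply j (T t z)"
  have "(\<lambda>n. \<mu> (r n) (left_translate s ?h) - \<mu> (r n) ?h) \<longlonglongrightarrow> 0"
    using LIMSEQ_subseq_LIMSEQ[OF left_regular_tendsto[OF subspace invariant regular orbit[OF z]] r]
    by (simp add: o_def)
  moreover have "(\<lambda>n. \<mu> (r n) ?h) \<longlonglongrightarrow> blinfun_apply j z"
    using blinfun.tendsto[OF tendsto_const lim, of j] by (simp add: T_mean_apply[OF mean z])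
  ultimately have "(\<lambda>n. (\<mu> (r n) (left_translate s ?h) - \<mu> (r n) ?h) + \<mu> (r n) ?h) \<longlonglongrightarrow> 0 + blinfun_apply j z"
    by (rule tendsto_add)
  then show "(\<lambda>n. \<mu> (r n) (\<lambda>t. blinfun_apply j (T (s * t) z))) \<longlonglongrightarrow> blinfun_apply j z"
    by (simp add: left_translate_def)
qed

text \<open>By the implicit equation, a backward step from \<open>z n - p\<close> along
  \<open>f (z n) - z n\<close> lands on the mean operator's value minus \<open>p\<close>, which is
  no longer than \<open>z n - p\<close> because \<open>p\<close> is fixed.\<close>

lemma implicit_iteration_ray:
  assumes z: "implicit_iteration f z" and p: "p \<in> Fix_rep C T" and t: "t \<ge> 0"
  shows "norm (z n - p) \<le> norm (z n - p + t *\<^sub>R (f (z n) - z n))"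
proof (rule norm_le_ray[of "\<epsilon> n / (1 - \<epsilon> n)"])
  define e where "e = \<epsilon> n"
  have e: "0 < e" "e < 1" using \<epsilon>[of n] by (simp_all add: e_def)
  then show "0 < \<epsilon> n / (1 - \<epsilon> n)" by (simp add: e_def)
  define A where "A = T_mean (\<mu> n) T (z n)"
  have zC: "z n \<in> C" and eq: "z n = e *\<^sub>R f (z n) + (1 - e) *\<^sub>R A"
    using z by (auto simp: implicit_iteration_def A_def e_def)
  have "(1 - e) *\<^sub>R A = z n - e *\<^sub>R f (z n)" by (metis add_diff_cancel_left' eq)
  then have "(1 - e) *\<^sub>R (z n - A) = e *\<^sub>R (f (z n) - z n)"
    by (simp only: scaleR_diff_right) (simp add: algebra_simps)
  then have "(1 / (1 - e)) *\<^sub>R ((1 - e) *\<^sub>R (z n - A)) = (1 / (1 - e)) *\<^sub>R (e *\<^sub>R (f (z n) - z n))" by simp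
  then have "z n - A = (e / (1 - e)) *\<^sub>R (f (z n) - z n)" using e by simp
  then have "z n - p - (e / (1 - e)) *\<^sub>R (f (z n) - z n) = A - p" by (simp add: algebra_simps)
  moreover have "norm (A - p) \<le> norm (z n - p)"
    using T_mean_nonexpansive[OF mean zC, of p n] T_mean_fixed[OF mean p, of n] p
    by (simp add: A_def Fix_rep_def)
  ultimately show "norm (z n - p - (\<epsilon> n / (1 - \<epsilon> n)) *\<^sub>R (f (z n) - z n)) \<le> norm (z n - p)"
    by (simp only: e_def)
qed (rule t)

text \<open>The implicit equation makes the residual of order \<open>\<epsilon> n\<close>, so the
  limit is a fixed point; the ray inequality then passes to the limit.\<close>

lemma implicit_iteration_cluster_point:
  assumes f: "f ` C \<subseteq> C"
    and contr: "\<And>x y. x \<in> C \<Longrightarrow> y \<in> C \<Longrightarrow> norm (f x - f y) \<le> \<alpha> * norm (x - y)"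
    and z: "implicit_iteration f z" and r: "strict_mono r" and lim: "(\<lambda>n. z (r n)) \<longlonglongrightarrow> q"
  shows "sunny_point (Fix_rep C T) (f q) q"
proof -
  have zC: "z n \<in> C" for n using z by (simp add: implicit_iteration_def)
  have q: "q \<in> C" by (rule closed_sequentially[OF compact_imp_closed[OF compact] _ lim]) (rule zC)
  define A where "A n = T_mean (\<mu> n) T" for n
  have AC: "A n x \<in> C" if "x \<in> C" for n x unfolding A_def by (rule T_mean_in[OF mean that])
  have dist0: "(\<lambda>n. norm (z (r n) - q)) \<longlonglongrightarrow> 0" using lim by (simp add: LIM_zero tendsto_norm_zero)
  obtain B where B: "\<And>y. y \<in> C \<Longrightarrow> norm y \<le> B"
    using compact_imp_bounded[OF compact] by (auto simp: bounded_iff)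
  have residual: "norm (A n (z n) - z n) \<le> \<epsilon> n * (2 * B)" for n
  proof -
    have eq: "z n = \<epsilon> n *\<^sub>R f (z n) + (1 - \<epsilon> n) *\<^sub>R A n (z n)"
      using z unfolding implicit_iteration_def A_def by blast
    have "A n (z n) - (\<epsilon> n *\<^sub>R f (z n) + (1 - \<epsilon> n) *\<^sub>R A n (z n)) = \<epsilon> n *\<^sub>R (A n (z n) - f (z n))"
      by (simp add: algebra_simps)
    then have "A n (z n) - z n = \<epsilon> n *\<^sub>R (A n (z n) - f (z n))" by (simp only: eq[symmetric])
    also have "norm \<dots> = \<epsilon> n * norm (A n (z n) - f (z n))" using \<epsilon>[of n] by simp
    also have "norm (A n (z n) - f (z n)) \<le> B + B"
      using B[OF AC[OF zC]] B[of "f (z n)"] f zC[of n] norm_triangle_ineq4[of "A n (z n)" "f (z n)"]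
      by (smt (verit) image_subset_iff)
    finally show ?thesis using \<epsilon>[of n] by simp
  qed
  have bound: "norm (A (r n) q - q) \<le> 2 * norm (z (r n) - q) + \<epsilon> (r n) * (2 * B)" for n
  proof -
    have "norm (A (r n) q - A (r n) (z (r n))) \<le> norm (z (r n) - q)"
      unfolding A_def using T_mean_nonexpansive[OF mean q zC, of "r n" "r n"] by (simp add: norm_minus_commute)
    moreover have "A (r n) q - q = (A (r n) q - A (r n) (z (r n))) + ((A (r n) (z (r n)) - z (r n)) + (z (r n) - q))"
      by simp
    ultimately show ?thesis
      using residual[of "r n"] norm_triangle_ineq norm_add_leD
      by (smt (verit))
  qed
  have "(\<lambda>n. 2 * norm (z (r n) - q) + \<epsilon> (r n) * (2 * B)) \<longlonglongrightarrow> 2 * 0 + 0 * (2 * B)"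
    using LIMSEQ_subseq_LIMSEQ[OF \<epsilon>_lim r] by (intro tendsto_intros dist0) (simp add: o_def)
  then have "(\<lambda>n. 2 * norm (z (r n) - q) + \<epsilon> (r n) * (2 * B)) \<longlonglongrightarrow> 0" by simp
  then have "(\<lambda>n. A (r n) q - q) \<longlonglongrightarrow> 0"
    by (rule Lim_null_comparison[OF always_eventually[OF allI[OF bound]]])
  then have "(\<lambda>n. T_mean (\<mu> (r n)) T q) \<longlonglongrightarrow> q" by (simp add: A_def LIM_zero_cancel)
  then have "q \<in> Fix_rep C T" by (rule approximate_fixed_point_in_Fix_rep[OF q r])
  moreover have f_lim: "(\<lambda>n. f (z (r n))) \<longlonglongrightarrow> f q"
  proof (rule LIM_zero_cancel, rule Lim_null_comparison)
    show "\<forall>\<^sub>F n in sequentially. norm (f (z (r n)) - f q) \<le> \<alpha> * norm (z (r n) - q)"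
      using contr[OF zC q] by simp
    show "(\<lambda>n. \<alpha> * norm (z (r n) - q)) \<longlonglongrightarrow> 0" using tendsto_mult_left[OF dist0, of \<alpha>] by simp
  qed
  have "norm (q - p) \<le> norm (q - p + t *\<^sub>R (f q - q))" if p: "p \<in> Fix_rep C T" and t: "t \<ge> 0" for p t
  proof (rule LIMSEQ_le)
    show "(\<lambda>n. norm (z (r n) - p)) \<longlonglongrightarrow> norm (q - p)" by (intro tendsto_intros lim)
    show "(\<lambda>n. norm (z (r n) - p + t *\<^sub>R (f (z (r n)) - z (r n)))) \<longlonglongrightarrow> norm (q - p + t *\<^sub>R (f q - q))"
      by (intro tendsto_intros lim f_lim)
  qed (use implicit_iteration_ray[OF z p t] in auto)
  ultimately show ?thesis unfolding sunny_point_def by blast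
qed

text \<open>Any two cluster points satisfy \<open>norm (l - q) \<le> norm (f l - f q)\<close>, and
  the contraction constant forces \<open>l = q\<close>. The limit is therefore the same for all
  iterations with this \<open>f\<close>.\<close>

lemma implicit_iteration_converges:
  assumes f: "f ` C \<subseteq> C" and \<alpha>: "0 \<le> \<alpha>" "\<alpha> < 1"
    and contr: "\<And>x y. x \<in> C \<Longrightarrow> y \<in> C \<Longrightarrow> norm (f x - f y) \<le> \<alpha> * norm (x - y)"
  obtains q where "sunny_point (Fix_rep C T) (f q) q" "\<And>z. implicit_iteration f z \<Longrightarrow> z \<longlonglongrightarrow> q"
proof -
  obtain z0 where z0: "implicit_iteration f z0" using implicit_iteration_exists[OF f \<alpha> contr] by blast
  have "\<forall>n. z0 n \<in> C" using z0 by (simp add: implicit_iteration_def)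
  then obtain q r where r: "strict_mono r" and "(z0 \<circ> r) \<longlonglongrightarrow> q"
    using compact[unfolded compact_def, rule_format, of z0] by blast
  then have q: "sunny_point (Fix_rep C T) (f q) q"
    by (intro implicit_iteration_cluster_point[OF f contr z0 r]) (simp_all add: o_def)
  show thesis
  proof (rule that[OF q])
    fix z assume z: "implicit_iteration f z"
    then have zC: "z n \<in> C" for n by (simp add: implicit_iteration_def)
    show "z \<longlonglongrightarrow> q"
    proof (rule compact_cluster_point_tendsto[OF compact zC])
      fix r l assume r: "strict_mono r" and lim: "(\<lambda>n. z (r n)) \<longlonglongrightarrow> l"
      have l: "sunny_point (Fix_rep C T) (f l) l"
        by (rule implicit_iteration_cluster_point[OF f contr z r lim])
      have "norm (l - q) \<le> norm (f l - f q)" by (rule sunny_point_nonexpansive[OF smooth l q])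
      also have "\<dots> \<le> \<alpha> * norm (l - q)"
        using l q by (intro contr) (auto simp: sunny_point_def Fix_rep_def)
      finally have "(1 - \<alpha>) * norm (l - q) \<le> 0" by (simp add: algebra_simps)
      then show "l = q" using \<alpha>(2) by (simp add: mult_le_0_iff)
    qed
  qed
qed

lemma sunny_nonexpansive_retraction_exists: "\<exists>P. sunny_nonexpansive_retraction C (Fix_rep C T) P"
proof -
  \<comment> \<open>A constant map is a contraction with constant 0, and the limit it produces is a
    sunny point for \<open>u\<close>.\<close>
  have "\<exists>q. sunny_point (Fix_rep C T) u q" if "u \<in> C" for u
    by (rule implicit_iteration_converges[of "\<lambda>_. u" 0]) (use that in auto)
  then obtain P where "\<And>u. u \<in> C \<Longrightarrow> sunny_point (Fix_rep C T) u (P u)" by metis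
  then have "sunny_nonexpansive_retraction C (Fix_rep C T) P"
    by (intro sunny_point_retraction[OF smooth]) (auto simp: Fix_rep_def)
  then show ?thesis by blast
qed

lemma sunny_nonexpansive_retraction_unique:
  assumes "sunny_nonexpansive_retraction C (Fix_rep C T) P" "sunny_nonexpansive_retraction C (Fix_rep C T) Q"
    and "y \<in> C"
  shows "Q y = P y"
  by (rule sunny_point_unique[OF smooth
        sunny_nonexpansive_retraction_sunny_point[OF convex assms(2,3)]
        sunny_nonexpansive_retraction_sunny_point[OF convex assms(1,3)]])

end

lemma tendsto_fun_iff:
  fixes g :: "'n \<Rightarrow> 'i \<Rightarrow> 'e::topological_space"
  shows "(g \<longlongrightarrow> l) F \<longleftrightarrow> (\<forall>i. ((\<lambda>n. g n i) \<longlongrightarrow> l i) F)"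
  using limitin_componentwise[of "\<lambda>_. euclidean" UNIV g l F]
  by (simp add: euclidean_product_topology)

text \<open>Retractions are total functions here, so uniqueness means agreement on
  \<open>C i\<close>. Existence of the iterates is a separate conjunct, which keeps the convergence
  claim for all such iterates from being vacuous.\<close>

theorem theorem3p1:
  fixes C :: "'i \<Rightarrow> 'e::banach set"
    and T :: "'i \<Rightarrow> 's::semigroup_mult \<Rightarrow> 'e \<Rightarrow> 'e"
    and X :: "('s \<Rightarrow> real) set"
    and \<mu> :: "nat \<Rightarrow> ('s \<Rightarrow> real) \<Rightarrow> real"
    and f :: "'i \<Rightarrow> 'e \<Rightarrow> 'e"
    and \<alpha> :: "'i \<Rightarrow> real"
    and \<epsilon> :: "nat \<Rightarrow> real"
  assumes E_sc: "strictly_convex_space TYPE('e)"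
    and E_refl: "reflexive_space TYPE('e)"
    and E_smooth: "smooth_space TYPE('e)"
    and C: "\<And>i. C i \<noteq> {} \<and> compact (C i) \<and> convex (C i)"
    and T_rep: "\<And>i. nonexpansive_representation (C i) (T i)"
    and T_fix: "\<And>i. Fix_rep (C i) (T i) \<noteq> {}"
    and X_sub: "subspace_B X"
    and X_inv: "left_invariant X"
    and X_one: "(\<lambda>_. 1) \<in> X"
    and X_orbit: "\<And>i x x'. x \<in> C i \<Longrightarrow> (\<lambda>t. blinfun_apply (x' :: 'e \<Rightarrow>\<^sub>L real) (T i t x)) \<in> X"
    and \<mu>_reg: "left_regular X \<mu>"
    and f_maps: "\<And>i. f i ` C i \<subseteq> C i"
    and f_contr: "\<And>i x y. x \<in> C i \<Longrightarrow> y \<in> C i \<Longrightarrow> norm (f i x - f i y) \<le> \<alpha> i * norm (x - y)"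
    and \<alpha>: "\<And>i. 0 \<le> \<alpha> i \<and> \<alpha> i < 1"
    and \<epsilon>: "\<And>n. 0 < \<epsilon> n \<and> \<epsilon> n < 1"
    and \<epsilon>_lim: "\<epsilon> \<longlonglongrightarrow> 0"
  shows "\<exists>P :: 'i \<Rightarrow> 'e \<Rightarrow> 'e. \<exists>x :: 'i \<Rightarrow> 'e.
     (\<forall>i. sunny_nonexpansive_retraction (C i) (Fix_rep (C i) (T i)) (P i)
        \<and> (\<forall>Q. sunny_nonexpansive_retraction (C i) (Fix_rep (C i) (T i)) Q
               \<longrightarrow> (\<forall>y\<in>C i. Q y = P i y))
        \<and> x i \<in> C i)
   \<and> (\<exists>z :: nat \<Rightarrow> 'i \<Rightarrow> 'e. \<forall>n i. z n i \<in> C i \<and>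
        z n i = \<epsilon> n *\<^sub>R f i (z n i) + (1 - \<epsilon> n) *\<^sub>R T_mean (\<mu> n) (T i) (z n i))
   \<and> (\<forall>z :: nat \<Rightarrow> 'i \<Rightarrow> 'e.
        (\<forall>n i. z n i \<in> C i \<and>
           z n i = \<epsilon> n *\<^sub>R f i (z n i) + (1 - \<epsilon> n) *\<^sub>R T_mean (\<mu> n) (T i) (z n i))
        \<longrightarrow> (\<lambda>n. z n) \<longlonglongrightarrow> (\<lambda>i. P i (x i)))"
proof -
  have V: "viscosity (C i) (T i) X \<mu> \<epsilon>" for i
    by unfold_locales (use assms in auto)
  have it: "viscosity.implicit_iteration (C i) (T i) \<mu> \<epsilon> (f i) (\<lambda>n. z n i) \<longleftrightarrow>
      (\<forall>n. z n i \<in> C i \<and> z n i = \<epsilon> n *\<^sub>R f i (z n i) + (1 - \<epsilon> n) *\<^sub>R T_mean (\<mu> n) (T i) (z n i))"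
    for z :: "nat \<Rightarrow> 'i \<Rightarrow> 'e" and i
    by (rule viscosity.implicit_iteration_def[OF V])
  have "\<exists>P. sunny_nonexpansive_retraction (C i) (Fix_rep (C i) (T i)) P" for i
    by (rule viscosity.sunny_nonexpansive_retraction_exists[OF V])
  then obtain P where P: "\<And>i. sunny_nonexpansive_retraction (C i) (Fix_rep (C i) (T i)) (P i)" by metis
  have "\<exists>q. q \<in> Fix_rep (C i) (T i) \<and>
      (\<forall>z. viscosity.implicit_iteration (C i) (T i) \<mu> \<epsilon> (f i) z \<longrightarrow> z \<longlonglongrightarrow> q)" for i
    using viscosity.implicit_iteration_converges[OF V, of "f i" i "\<alpha> i"] f_maps \<alpha> f_contr
    unfolding sunny_point_def by metis
  then obtain q where q: "\<And>i. q i \<in> Fix_rep (C i) (T i)"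
    and conv: "\<And>i z. viscosity.implicit_iteration (C i) (T i) \<mu> \<epsilon> (f i) z \<Longrightarrow> z \<longlonglongrightarrow> q i"
    by metis
  \<comment> \<open>The limit \<open>q i\<close> lies in the fixed point set, so it can itself be
    taken as the point \<open>x i\<close>.\<close>
  have Pq: "P i (q i) = q i" for i
    using P[of i] q[of i] by (simp add: sunny_nonexpansive_retraction_def retraction_onto_def)
  have "\<exists>z. viscosity.implicit_iteration (C i) (T i) \<mu> \<epsilon> (f i) z" for i
    using viscosity.implicit_iteration_exists[OF V f_maps] \<alpha> f_contr by metis
  then obtain z where z: "\<And>i. viscosity.implicit_iteration (C i) (T i) \<mu> \<epsilon> (f i) (z i)" by metis
  show ?thesis
  proof (intro exI[of _ P] exI[of _ q] conjI allI impI)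
    show "q i \<in> C i" for i using q[of i] by (simp add: Fix_rep_def)
    show "\<forall>y\<in>C i. Q y = P i y" if "sunny_nonexpansive_retraction (C i) (Fix_rep (C i) (T i)) Q" for i Q
      using viscosity.sunny_nonexpansive_retraction_unique[OF V P that] by blast
    show "\<exists>z. \<forall>n i. z n i \<in> C i \<and>
        z n i = \<epsilon> n *\<^sub>R f i (z n i) + (1 - \<epsilon> n) *\<^sub>R T_mean (\<mu> n) (T i) (z n i)"
      using z it[where z = "\<lambda>n i. z i n"] by (intro exI[of _ "\<lambda>n i. z i n"]) blast
    fix z :: "nat \<Rightarrow> 'i \<Rightarrow> 'e"
    assume "\<forall>n i. z n i \<in> C i \<and>
        z n i = \<epsilon> n *\<^sub>R f i (z n i) + (1 - \<epsilon> n) *\<^sub>R T_mean (\<mu> n) (T i) (z n i)"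
    then have "(\<lambda>n. z n i) \<longlonglongrightarrow> q i" for i using it conv by blast
    then show "(\<lambda>n. z n) \<longlonglongrightarrow> (\<lambda>i. P i (q i))" by (simp add: tendsto_fun_iff Pq)
  qed (rule P)
qed

end
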